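(* Suppose that $Z$ is an $(m,h)$ subset of a manifold $\Omega$ with $C^1$ Riemannian metric, and that $Z$ is a subset of a connected, $C^1$, properly embedded, $m$-dimensional submanifold $M$ (without boundary) of $\Omega$. Then $Z=\emptyset$ or $Z=M$.
   Context: Definition of $(m,h)$ subset: let $\Omega$ be a smooth manifold without boundary with a $C^1$ Riemannian metric $g$. A closed subset $Z\subset\Omega$ is an $(m,h)$ subset (or $(m,h)$ set) if, whenever $f:\Omega\to\mathbf{R}$ is a $C^2$ function such that $f|Z$ has a local maximum at $p\in Z$, we have $\operatorname{Trace}_m(\mathrm{D}^2f(p))\le h\,|\mathrm{D}f(p)|$. Here $\mathrm{D}^2f$ is the Hessian of $f$ with respect to $g$, $|\mathrm{D}f|$ is the norm of the derivative with respect to $g$, and $\operatorname{Trace}_m$ denotes the sum of the $m$ lowest eigenvalues (with respect to $g$, counted with multiplicity). *)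

theory Defs
  imports "HOL-Analysis.Analysis"
begin

section \<open>Functions of class \<open>C\<^sup>k\<close> on open subsets of a Euclidean space\<close>

primrec Ck_on :: "nat \<Rightarrow> 'e::euclidean_space set \<Rightarrow> ('e \<Rightarrow> 'f::real_normed_vector) \<Rightarrow> bool" where
  "Ck_on 0 S f \<longleftrightarrow> continuous_on S f"
| "Ck_on (Suc k) S f \<longleftrightarrow>
     (\<forall>x\<in>S. f differentiable (at x)) \<and> (\<forall>v. Ck_on k S (\<lambda>x. frechet_derivative f (at x) v))"


section \<open>Smooth manifolds\<close>

text \<open>
  A chart is a pair \<open>(U, \<phi>)\<close>. Values of \<open>\<phi>\<close> outside \<open>U\<close> are irrelevant.
  The dimension of the manifold is \<open>DIM('e)\<close>.
\<close>

type_synonym ('a, 'e) chart = "'a set \<times> ('a \<Rightarrow> 'e)"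

abbreviation chart_dom :: "('a, 'e) chart \<Rightarrow> 'a set" where
  "chart_dom \<equiv> fst"

abbreviation chart_map :: "('a, 'e) chart \<Rightarrow> 'a \<Rightarrow> 'e" where
  "chart_map \<equiv> snd"

definition chart_inv :: "('a, 'e) chart \<Rightarrow> 'e \<Rightarrow> 'a" where
  "chart_inv c = inv_into (chart_dom c) (chart_map c)"

definition chart_img :: "('a, 'e) chart \<Rightarrow> 'e set" where
  "chart_img c = chart_map c ` chart_dom c"

definition is_chart :: "'a topology \<Rightarrow> ('a, 'e::euclidean_space) chart \<Rightarrow> bool" where
  "is_chart X c \<longleftrightarrow> openin X (chart_dom c) \<and> open (chart_img c) \<and>
     homeomorphic_map (subtopology X (chart_dom c)) (top_of_set (chart_img c)) (chart_map c)"

definition transition :: "('a, 'e) chart \<Rightarrow> ('a, 'e) chart \<Rightarrow> 'e \<Rightarrow> 'e" where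
  "transition c d = chart_map d \<circ> chart_inv c"

definition Ck_compatible ::
    "nat \<Rightarrow> ('a, 'e::euclidean_space) chart \<Rightarrow> ('a, 'e) chart \<Rightarrow> bool" where
  "Ck_compatible k c d \<longleftrightarrow>
     Ck_on k (chart_map c ` (chart_dom c \<inter> chart_dom d)) (transition c d) \<and>
     Ck_on k (chart_map d ` (chart_dom c \<inter> chart_dom d)) (transition d c)"

text \<open>The atlas \<open>A\<close> is not required to be maximal.\<close>

definition smooth_manifold ::
    "'a topology \<Rightarrow> ('a, 'e::euclidean_space) chart set \<Rightarrow> bool" where
  "smooth_manifold X A \<longleftrightarrow>
     Hausdorff_space X \<and> second_countable X \<and>
     (\<forall>c\<in>A. is_chart X c) \<and> (\<Union>c\<in>A. chart_dom c) = topspace X \<and>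
     (\<forall>c\<in>A. \<forall>d\<in>A. \<forall>k. Ck_compatible k c d)"

definition Ck_function ::
    "nat \<Rightarrow> ('a, 'e::euclidean_space) chart set \<Rightarrow> ('a \<Rightarrow> real) \<Rightarrow> bool" where
  "Ck_function k A f \<longleftrightarrow> (\<forall>c\<in>A. Ck_on k (chart_img c) (f \<circ> chart_inv c))"


section \<open>Submanifolds\<close>

text \<open>
  An embedded \<open>C\<^sup>k\<close> submanifold (without boundary) of dimension \<open>m\<close> is locally a slice in a chart
  that is \<open>C\<^sup>k\<close>-compatible with the atlas, but need not belong to it.
\<close>

definition Ck_submanifold ::
    "nat \<Rightarrow> 'a topology \<Rightarrow> ('a, 'e::euclidean_space) chart set \<Rightarrow> nat \<Rightarrow> 'a set \<Rightarrow> bool" where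
  "Ck_submanifold k X A m M \<longleftrightarrow> M \<subseteq> topspace X \<and>
     (\<forall>p\<in>M. \<exists>c S. is_chart X c \<and> (\<forall>d\<in>A. Ck_compatible k c d) \<and> p \<in> chart_dom c \<and>
        subspace S \<and> dim S = m \<and>
        chart_map c ` (chart_dom c \<inter> M) = chart_img c \<inter> S)"

definition properly_embedded :: "'a topology \<Rightarrow> 'a set \<Rightarrow> bool" where
  "properly_embedded X M \<longleftrightarrow> proper_map (subtopology X M) X (\<lambda>x. x)"


section \<open>Riemannian metrics of class \<open>C\<^sup>k\<close>\<close>

text \<open>
  A metric is given by its components: \<open>g c p v w\<close> is the inner product at \<open>p\<close> of the
  tangent vectors whose coordinates in the chart \<open>c\<close> are \<open>v\<close> and \<open>w\<close>. The components in
  two charts are related by the transformation law of covariant 2-tensors.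
\<close>

type_synonym ('a, 'e) metric_components = "('a, 'e) chart \<Rightarrow> 'a \<Rightarrow> 'e \<Rightarrow> 'e \<Rightarrow> real"

definition Ck_riemannian_metric ::
    "nat \<Rightarrow> ('a, 'e::euclidean_space) chart set \<Rightarrow> ('a, 'e) metric_components \<Rightarrow> bool" where
  "Ck_riemannian_metric k A g \<longleftrightarrow>
     (\<forall>c\<in>A. \<forall>p\<in>chart_dom c.
        bilinear (g c p) \<and> (\<forall>v w. g c p v w = g c p w v) \<and> (\<forall>v. v \<noteq> 0 \<longrightarrow> g c p v v > 0)) \<and>
     (\<forall>c\<in>A. \<forall>v w. Ck_on k (chart_img c) (\<lambda>x. g c (chart_inv c x) v w)) \<and>
     (\<forall>c\<in>A. \<forall>d\<in>A. \<forall>p\<in>chart_dom c \<inter> chart_dom d. \<forall>v w.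
        g c p v w = g d p (frechet_derivative (transition c d) (at (chart_map c p)) v)
                          (frechet_derivative (transition c d) (at (chart_map c p)) w))"

text \<open>\<open>metric_deriv g c p u v w\<close> is \<open>\<partial>\<^sub>u (g(v, w))\<close> at \<open>p\<close> in the chart \<open>c\<close>.\<close>

definition metric_deriv ::
    "('a, 'e::euclidean_space) metric_components \<Rightarrow> ('a, 'e) chart \<Rightarrow> 'a \<Rightarrow> 'e \<Rightarrow> 'e \<Rightarrow> 'e \<Rightarrow> real"
  where
  "metric_deriv g c p u v w =
     frechet_derivative (\<lambda>x. g c (chart_inv c x) v w) (at (chart_map c p)) u"

text \<open>
  The Christoffel symbols of the Levi-Civita connection, as the vector
  \<open>\<Gamma>(v, w) = \<Sum> \<Gamma>\<^sub>i\<^sub>j\<^sup>k v\<^sub>i w\<^sub>j e\<^sub>k\<close>.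
\<close>

definition christoffel ::
    "('a, 'e::euclidean_space) metric_components \<Rightarrow> ('a, 'e) chart \<Rightarrow> 'a \<Rightarrow> 'e \<Rightarrow> 'e \<Rightarrow> 'e" where
  "christoffel g c p v w = (THE u. \<forall>z.
     g c p u z = (metric_deriv g c p v w z + metric_deriv g c p w v z - metric_deriv g c p z v w) / 2)"

definition deriv_at ::
    "('a, 'e::euclidean_space) chart \<Rightarrow> ('a \<Rightarrow> real) \<Rightarrow> 'a \<Rightarrow> 'e \<Rightarrow> real" where
  "deriv_at c f p v = frechet_derivative (f \<circ> chart_inv c) (at (chart_map c p)) v"

text \<open>
  The Hessian \<open>D\<^sup>2f = \<nabla>df\<close>, that is
  \<open>(D\<^sup>2f)\<^sub>i\<^sub>j = \<partial>\<^sub>i\<partial>\<^sub>j f - \<Gamma>\<^sub>i\<^sub>j\<^sup>k \<partial>\<^sub>k f\<close> in coordinates.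
\<close>

definition hessian ::
    "('a, 'e::euclidean_space) metric_components \<Rightarrow> ('a, 'e) chart \<Rightarrow> ('a \<Rightarrow> real) \<Rightarrow> 'a \<Rightarrow>
      'e \<Rightarrow> 'e \<Rightarrow> real" where
  "hessian g c f p v w =
     frechet_derivative (\<lambda>x. frechet_derivative (f \<circ> chart_inv c) (at x) w) (at (chart_map c p)) v
     - deriv_at c f p (christoffel g c p v w)"

text \<open>The operator norm of a linear form \<open>L\<close> with respect to the inner product \<open>G\<close>.\<close>

definition dual_norm :: "('e \<Rightarrow> 'e \<Rightarrow> real) \<Rightarrow> ('e \<Rightarrow> real) \<Rightarrow> real" where
  "dual_norm G L = (SUP v\<in>{v. G v v = 1}. \<bar>L v\<bar>)"


section \<open>Eigenvalues of a symmetric form with respect to an inner product\<close>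

definition eigenspace_wrt ::
    "('e \<Rightarrow> 'e \<Rightarrow> real) \<Rightarrow> ('e \<Rightarrow> 'e \<Rightarrow> real) \<Rightarrow> real \<Rightarrow> 'e::euclidean_space set" where
  "eigenspace_wrt G H l = {v. \<forall>w. H v w = l * G v w}"

definition eigenvalues_wrt ::
    "('e \<Rightarrow> 'e \<Rightarrow> real) \<Rightarrow> ('e::euclidean_space \<Rightarrow> 'e \<Rightarrow> real) \<Rightarrow> real set" where
  "eigenvalues_wrt G H = {l. \<exists>v\<in>eigenspace_wrt G H l. v \<noteq> 0}"

text \<open>All eigenvalues in increasing order, each repeated according to its multiplicity.\<close>

definition eigenvalue_list ::
    "('e \<Rightarrow> 'e \<Rightarrow> real) \<Rightarrow> ('e::euclidean_space \<Rightarrow> 'e \<Rightarrow> real) \<Rightarrow> real list" where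
  "eigenvalue_list G H =
     concat (map (\<lambda>l. replicate (dim (eigenspace_wrt G H l)) l)
                 (sorted_list_of_set (eigenvalues_wrt G H)))"

definition Trace_lowest ::
    "nat \<Rightarrow> ('e \<Rightarrow> 'e \<Rightarrow> real) \<Rightarrow> ('e::euclidean_space \<Rightarrow> 'e \<Rightarrow> real) \<Rightarrow> real" where
  "Trace_lowest m G H = sum_list (take m (eigenvalue_list G H))"


section \<open>\<open>(m, h)\<close> subsets\<close>

definition local_max_on :: "'a topology \<Rightarrow> 'a set \<Rightarrow> ('a \<Rightarrow> real) \<Rightarrow> 'a \<Rightarrow> bool" where
  "local_max_on X Z f p \<longleftrightarrow> (\<exists>V. openin X V \<and> p \<in> V \<and> (\<forall>q\<in>V \<inter> Z. f q \<le> f p))"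

text \<open>
  Both sides of the inequality are invariant under change of chart, so that the quantification
  over all charts of the atlas around \<open>p\<close> amounts to the choice of any one of them.
\<close>

definition mh_subset ::
    "'a topology \<Rightarrow> ('a, 'e::euclidean_space) chart set \<Rightarrow> ('a, 'e) metric_components \<Rightarrow>
      nat \<Rightarrow> real \<Rightarrow> 'a set \<Rightarrow> bool" where
  "mh_subset X A g m h Z \<longleftrightarrow> closedin X Z \<and>
     (\<forall>f p. Ck_function 2 A f \<and> p \<in> Z \<and> local_max_on X Z f p \<longrightarrow>
        (\<forall>c\<in>A. p \<in> chart_dom c \<longrightarrow>
           Trace_lowest m (g c p) (hessian g c f p) \<le> h * dual_norm (g c p) (deriv_at c f p)))"

end

theory Submission
  imports Defs
begin

text \<open>
  If \<open>Z\<close> is neither empty nor all of \<open>M\<close>, connectedness yields points of \<open>M - Z\<close> arbitrarily close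
  to a point of \<open>Z\<close>. In a smooth chart take such a point \<open>q\<close> and a point \<open>p\<close> of \<open>Z\<close> closest to it
  in the Euclidean distance of the chart, so that \<open>Z\<close> avoids a ball touching \<open>p\<close> whose centre lies in
  the direction \<open>e = q - p\<close>. As \<open>M\<close> is \<open>C\<^sup>1\<close>, the secant \<open>e\<close> is not normal to the tangent space \<open>T\<close>
  of \<open>M\<close> at \<open>p\<close>. With \<open>v = x - p\<close> and an orthonormal basis \<open>N\<close> of the orthogonal complement of \<open>T\<close>,
  the function \<open>v \<bullet> e - \<bar>v\<bar>\<^sup>2 + B ((v \<bullet> e)\<^sup>2 + \<Sum>b\<in>N. (v \<bullet> b)\<^sup>2)\<close> restricted to \<open>Z\<close> has a local maximum
  at \<open>p\<close> for every \<open>B > 0\<close>: the ball condition bounds \<open>v \<bullet> e\<close> by \<open>\<bar>v\<bar>\<^sup>2 / 2\<close>, and the components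
  normal to \<open>M\<close> are \<open>o(\<bar>v\<bar>)\<close>. Its derivative at \<open>p\<close> does not depend on \<open>B\<close>, but its Hessian grows like
  \<open>B\<close> on a subspace of codimension \<open>m - 1\<close>, so that the sum of its \<open>m\<close> lowest eigenvalues is
  unbounded in \<open>B\<close>. Only the values of the metric and of the Christoffel symbols at \<open>p\<close> enter.
\<close>

section \<open>Eigenvalues of a symmetric form relative to an inner product\<close>

text \<open>The quotient \<open>H v v / G v v\<close> is homogeneous of degree 0, so its minimum
  over the compact unit sphere of \<open>W\<close> is its minimum over all nonzero vectors of
  \<open>W\<close>. It yields the eigenvector in the spectral theorem and the constants that bound
  one form by another.\<close>

lemma bilinear_rayleigh_quotient_min:
  fixes G H :: "'e::euclidean_space \<Rightarrow> 'e \<Rightarrow> real"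
  assumes G: "bilinear G" and H: "bilinear H" and W: "subspace W" "W \<noteq> {0}"
    and pos: "\<And>v. v \<in> W \<Longrightarrow> v \<noteq> 0 \<Longrightarrow> G v v > 0"
  obtains l v0 where "v0 \<in> W" "v0 \<noteq> 0" "H v0 v0 = l * G v0 v0"
    "\<And>v. v \<in> W \<Longrightarrow> l * G v v \<le> H v v"
proof -
  let ?K = "W \<inter> sphere 0 1"
  have "compact ?K"
    by (simp add: W closed_Int_compact closed_subspace)
  obtain w where "w \<in> W" "w \<noteq> 0"
    using W subspace_0 by blast
  then have "w /\<^sub>R norm w \<in> ?K"
    using W by (simp add: subspace_scale)
  then have "?K \<noteq> {}" by blast
  have cont: "continuous_on ?K (\<lambda>v. F v v)" if "bilinear F" for F :: "'e \<Rightarrow> 'e \<Rightarrow> real"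
    using bilinear_continuous_on_compose[OF continuous_on_id continuous_on_id that] .
  have contq: "continuous_on ?K (\<lambda>v. H v v / G v v)"
    by (rule continuous_on_divide[OF cont[OF H] cont[OF G]]) (use pos in force)
  obtain v0 where v0: "v0 \<in> ?K" and min: "\<And>v. v \<in> ?K \<Longrightarrow> H v0 v0 / G v0 v0 \<le> H v v / G v v"
    using continuous_attains_inf[OF \<open>compact ?K\<close> \<open>?K \<noteq> {}\<close> contq] by blast
  have "v0 \<noteq> 0" using v0 by auto
  let ?l = "H v0 v0 / G v0 v0"
  show thesis
  proof
    show "v0 \<in> W" "v0 \<noteq> 0" "H v0 v0 = ?l * G v0 v0"
      using v0 \<open>v0 \<noteq> 0\<close> pos[of v0] by auto
    fix v assume v: "v \<in> W"
    show "?l * G v v \<le> H v v"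
    proof (cases "v = 0")
      case True
      then show ?thesis by (simp add: bilinear_lzero G H)
    next
      case False
      let ?u = "v /\<^sub>R norm v"
      have "?u \<in> ?K" using v False W by (simp add: subspace_scale)
      then have "?l \<le> H ?u ?u / G ?u ?u" by (rule min)
      also have "\<dots> = H v v / G v v"
        using False by (simp add: bilinear_lmul bilinear_rmul G H)
      finally show ?thesis
        using pos[OF v False] by (simp add: field_simps)
    qed
  qed
qed

text \<open>Along the line \<open>w + s *\<^sub>R v\<close> the form is affine in \<open>s\<close>
  with slope \<open>2 * H v w\<close>, and an affine function bounded below is constant.\<close>

lemma psd_form_isotropic_imp_radical:
  fixes H :: "'e::euclidean_space \<Rightarrow> 'e \<Rightarrow> real"
  assumes H: "bilinear H" and sym: "\<And>v w. H v w = H w v" and W: "subspace W"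
    and psd: "\<And>v. v \<in> W \<Longrightarrow> 0 \<le> H v v"
    and v: "v \<in> W" "H v v = 0" and w: "w \<in> W"
  shows "H v w = 0"
proof (rule ccontr)
  assume nz: "H v w \<noteq> 0"
  \<comment> \<open>The parameter at which that affine function equals -1.\<close>
  let ?s = "- (H w w + 1) / (2 * H v w)"
  have "w + ?s *\<^sub>R v \<in> W"
    using W v w by (simp add: subspace_add subspace_mul)
  then have "0 \<le> H (w + ?s *\<^sub>R v) (w + ?s *\<^sub>R v)" by (rule psd)
  also have "\<dots> = H w w + 2 * ?s * H v w"
    using v(2) sym[of w v]
    by (simp add: bilinear_ladd[OF H] bilinear_radd[OF H] bilinear_lmul[OF H] bilinear_rmul[OF H])
  also have "\<dots> = -1" using nz by (simp add: field_simps)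
  finally show False by simp
qed

lemma sorted_concat_replicate:
  "sorted xs \<Longrightarrow> sorted (concat (map (\<lambda>x. replicate (n x) x) xs))"
  by (induction xs) (auto simp: sorted_append)

lemma length_filter_concat_replicate:
  "length (filter P (concat (map (\<lambda>x. replicate (n x) x) xs)))
    = sum_list (map n (filter P xs))"
  by (induction xs) auto

lemma sum_Basis_inner:
  fixes L :: "'e::euclidean_space \<Rightarrow> real"
  assumes "linear L"
  shows "(\<Sum>b\<in>Basis. L b *\<^sub>R b) \<bullet> z = L z"
proof -
  have "L (\<Sum>b\<in>Basis. (z \<bullet> b) *\<^sub>R b) = (\<Sum>b\<in>Basis. (z \<bullet> b) * L b)"
    using assms by (simp add: linear_sum linear_cmul)
  then have "L z = (\<Sum>b\<in>Basis. (z \<bullet> b) * L b)"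
    unfolding euclidean_representation .
  then show ?thesis unfolding inner_sum_left by (simp add: inner_commute mult.commute)
qed

locale inner_form =
  fixes G :: "'e::euclidean_space \<Rightarrow> 'e \<Rightarrow> real"
  assumes bilinear: "bilinear G" and sym: "G v w = G w v" and pos: "v \<noteq> 0 \<Longrightarrow> 0 < G v v"
begin

lemma nonneg: "0 \<le> G v v"
  using pos[of v] bilinear_lzero[OF bilinear] by (cases "v = 0") auto

lemma eq_0_iff: "G v v = 0 \<longleftrightarrow> v = 0"
  using pos[of v] bilinear_lzero[OF bilinear] by force

text \<open>The musical isomorphism, with covectors identified with vectors by the Euclidean inner
  product; it reduces questions about \<open>G\<close> to Euclidean ones.\<close>

definition flat :: "'e \<Rightarrow> 'e" where
  "flat u = (\<Sum>b\<in>Basis. G u b *\<^sub>R b)"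

lemma inner_flat: "flat u \<bullet> z = G u z"
  unfolding flat_def using bilinear by (intro sum_Basis_inner) (simp add: bilinear_def)

lemma linear_flat: "linear flat"
  unfolding flat_def
  by (rule linearI) (auto simp: bilinear_ladd[OF bilinear] bilinear_lmul[OF bilinear]
      scaleR_add_left sum.distrib scaleR_sum_right)

text \<open>Definiteness makes \<open>flat\<close> injective, hence surjective by dimension. This
  Riesz representation gives meaning to the definite description in
  \<open>christoffel\<close>.\<close>

lemma representation:
  assumes "linear L"
  shows "\<exists>!u. \<forall>z. G u z = L z"
proof -
  have "u = 0" if "flat u = 0" for u
    using inner_flat[of u u] that by (simp only: inner_zero_left flip: eq_0_iff)
  then have "inj flat"
    unfolding linear_injective_0[OF linear_flat] by blast
  then have "surj flat" using linear_flat linear_injective_imp_surjective by blast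
  then obtain u where u: "(\<Sum>b\<in>Basis. L b *\<^sub>R b) = flat u" by (rule surjE)
  have L: "L z = G u z" for z
    using sum_Basis_inner[OF assms, of z] inner_flat[of u z] unfolding u by simp
  show ?thesis
  proof (rule ex1I)
    show "\<forall>z. G u z = L z" using L by simp
    fix u' assume "\<forall>z. G u' z = L z"
    then have "G (u' - u) (u' - u) = 0"
      by (simp add: L bilinear_lsub[OF bilinear])
    then show "u' = u" by (simp add: eq_0_iff)
  qed
qed

text \<open>The \<open>G\<close>-complement of \<open>V\<close> is the Euclidean complement of the
  image of \<open>V\<close> under \<open>flat\<close>, and that image has dimension at most
  \<open>dim V\<close>.\<close>

lemma dim_orthogonal_complement_ge:
  assumes "subspace V"
  shows "DIM('e) \<le> dim V + dim {w. \<forall>v\<in>V. G v w = 0}"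
proof -
  have "{w. \<forall>v\<in>V. G v w = 0} = {y \<in> UNIV. \<forall>x \<in> flat ` V. orthogonal x y}"
    by (auto simp: orthogonal_def inner_flat)
  moreover have "dim {y \<in> UNIV. \<forall>x \<in> flat ` V. orthogonal x y} + dim (flat ` V) = dim (UNIV :: 'e set)"
    using assms linear_flat by (intro dim_subspace_orthogonal_to_vectors) (auto simp: linear_subspace_image)
  moreover have "dim (flat ` V) \<le> dim V" using linear_flat dim_image_le by blast
  ultimately show ?thesis by simp
qed

end

section \<open>Eigenspaces and the spectral theorem\<close>

locale symmetric_form = inner_form G for G :: "'e::euclidean_space \<Rightarrow> 'e \<Rightarrow> real" +
  fixes H :: "'e \<Rightarrow> 'e \<Rightarrow> real"
  assumes bilinear_H: "bilinear H" and sym_H: "H v w = H w v"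
begin

abbreviation "eigspace \<equiv> eigenspace_wrt G H"

definition eigsum :: "real set \<Rightarrow> 'e set" where
  "eigsum F = span (\<Union>l\<in>F. eigspace l)"

lemma subspace_eigspace: "subspace (eigspace l)"
  unfolding eigenspace_wrt_def subspace_def
  by (auto simp: bilinear bilinear_H bilinear_lzero bilinear_ladd bilinear_lmul algebra_simps)

lemma eigsum_empty [simp]: "eigsum {} = {0}"
  by (simp add: eigsum_def)

lemma eigsum_insert: "eigsum (insert l F) = {a + b |a b. a \<in> eigspace l \<and> b \<in> eigsum F}"
proof -
  have "span (eigspace l) = eigspace l" using subspace_eigspace by simp
  then show ?thesis unfolding eigsum_def UN_insert span_Un by blast
qed

text \<open>For an eigenvector \<open>b\<close> of eigenvalue \<open>k\<close>, symmetry gives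
  \<open>l * G a b = H a b = k * G a b\<close> with \<open>l \<noteq> k\<close>; linearity extends
  this to the span.\<close>

lemma eigsum_orthogonal:
  assumes "l \<notin> F" "a \<in> eigspace l" "b \<in> eigsum F"
  shows "G a b = 0"
  using assms(3) unfolding eigsum_def
proof (induction b rule: span_induct)
  case base
  show ?case
    by (auto simp: subspace_def bilinear bilinear_rzero bilinear_radd bilinear_rmul)
next
  case (step b)
  then obtain k where k: "k \<in> F" "b \<in> eigspace k" by blast
  have "l * G a b = k * G a b"
    using assms(2) k(2) sym_H[of a b] sym[of a b] by (auto simp: eigenspace_wrt_def)
  then show ?case using assms(1) k(1) by auto
qed

lemma dim_eigsum:
  "finite F \<Longrightarrow> dim (eigsum F) = (\<Sum>l\<in>F. dim (eigspace l))"
proof (induction F rule: finite_induct)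
  case empty
  then show ?case by simp
next
  case (insert l F)
  have "eigspace l \<inter> eigsum F = {0}"
  proof -
    have "x = 0" if "x \<in> eigspace l" "x \<in> eigsum F" for x
      using eigsum_orthogonal[OF insert.hyps(2) that] eq_0_iff by blast
    moreover have "0 \<in> eigspace l" "0 \<in> eigsum F"
      using subspace_eigspace subspace_0 by (auto simp: eigsum_def span_zero)
    ultimately show ?thesis by blast
  qed
  then have "dim (eigsum (insert l F)) = dim (eigspace l) + dim (eigsum F)"
    using dim_sums_Int[OF subspace_eigspace[of l], of "eigsum F"]
    by (simp add: eigsum_insert) (simp add: eigsum_def)
  then show ?case using insert by simp
qed

text \<open>The eigenspaces are independent and each has dimension at least 1, so there are at most
  \<open>DIM('e)\<close> of them. Finiteness matters because \<open>sorted_list_of_set\<close>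
  returns the empty list on an infinite set.\<close>

lemma finite_eigenvalues: "finite (eigenvalues_wrt G H)"
proof -
  have "card F \<le> DIM('e)" if F: "F \<subseteq> eigenvalues_wrt G H" "finite F" for F
  proof -
    have "1 \<le> dim (eigspace l)" if "l \<in> F" for l
    proof -
      have "l \<in> eigenvalues_wrt G H" using F that by blast
      then obtain v where "v \<in> eigspace l" "v \<noteq> 0" unfolding eigenvalues_wrt_def by blast
      then have "dim (eigspace l) \<noteq> 0" unfolding dim_eq_0 by blast
      then show ?thesis by linarith
    qed
    then have "card F \<le> (\<Sum>l\<in>F. dim (eigspace l))"
      using sum_mono[of F "\<lambda>_. 1::nat"] by simp
    also have "\<dots> \<le> DIM('e)"
      using dim_eigsum[OF F(2)] dim_subset_UNIV by metis
    finally show ?thesis .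
  qed
  then show ?thesis
    using finite_if_finite_subsets_card_bdd[of "eigenvalues_wrt G H" "DIM('e)"] by blast
qed

text \<open>Induction splits off one eigenspace at a time; orthogonality kills the cross terms of
  both forms, so the inequality can be added up componentwise.\<close>

lemma eigsum_less:
  assumes "finite F" "\<And>l. l \<in> F \<Longrightarrow> l < t" "v \<in> eigsum F" "v \<noteq> 0"
  shows "H v v < t * G v v"
  using assms
proof (induction F arbitrary: v rule: finite_induct)
  case empty
  then show ?case by simp
next
  case (insert l F)
  then obtain a b where v: "v = a + b" and a: "a \<in> eigspace l" and b: "b \<in> eigsum F"
    by (auto simp: eigsum_insert)
  have Gab: "G a b = 0" "G b a = 0"
    using eigsum_orthogonal[OF insert.hyps(2) a b] sym[of a b] by auto
  have Haa: "H a a = l * G a a" and Hab: "H a b = 0" and Hba: "H b a = 0"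
    using a Gab sym_H[of a b] by (auto simp: eigenspace_wrt_def)
  have Hv: "H v v = l * G a a + H b b"
    by (simp add: v bilinear_ladd[OF bilinear_H] bilinear_radd[OF bilinear_H] Haa Hab Hba)
  have Gv: "G v v = G a a + G b b"
    by (simp add: v bilinear_ladd[OF bilinear] bilinear_radd[OF bilinear] Gab)
  have "l < t" using insert.prems by simp
  have 1: "l * G a a \<le> t * G a a" "a \<noteq> 0 \<Longrightarrow> l * G a a < t * G a a"
    using nonneg[of a] pos[of a] \<open>l < t\<close> by (auto intro: mult_right_mono)
  have 2: "H b b < t * G b b" if "b \<noteq> 0"
    using insert.IH[OF _ b that] insert.prems by simp
  show ?case
  proof (cases "b = 0")
    case True
    then show ?thesis using Hv Gv 1 insert.prems v
      by (simp add: bilinear bilinear_H bilinear_lzero)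
  next
    case False
    then show ?thesis using 2 1(1) Hv Gv by (simp add: algebra_simps)
  qed
qed

text \<open>Otherwise the \<open>G\<close>-complement \<open>?W\<close> of the sum \<open>?V\<close>
  of all eigenspaces is nonzero, and the Rayleigh quotient has a minimiser \<open>v0\<close> on it.
  The form \<open>H - l * G\<close> pairs \<open>v0\<close> to 0 with \<open>?W\<close>, being
  nonnegative there and zero at \<open>v0\<close>, and with \<open>?V\<close>, since
  \<open>G\<close> and \<open>H\<close> both do. As \<open>?V\<close> and \<open>?W\<close> span the
  space, \<open>v0\<close> is an eigenvector, so it lies in \<open>?V\<close> and in
  \<open>?W\<close>.\<close>

lemma eigsum_eigenvalues: "eigsum (eigenvalues_wrt G H) = UNIV"
proof (rule ccontr)
  let ?V = "eigsum (eigenvalues_wrt G H)"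
  let ?W = "{w. \<forall>v\<in>?V. G v w = 0}"
  assume "?V \<noteq> UNIV"
  have V: "subspace ?V" by (simp add: eigsum_def)
  have W: "subspace ?W"
    by (auto simp: subspace_def bilinear bilinear_rzero bilinear_radd bilinear_rmul)
  have VW: "?V \<inter> ?W = {0}"
    using subspace_0[OF V] subspace_0[OF W] eq_0_iff by blast
  have ge: "DIM('e) \<le> dim ?V + dim ?W"
    by (rule dim_orthogonal_complement_ge[OF V])
  have "dim ?V < DIM('e)"
    using \<open>?V \<noteq> UNIV\<close> V by (metis dim_eq_full dim_subset_UNIV order_le_less span_eq_iff)
  then have "?W \<noteq> {0}" using ge by auto
  obtain l v0 where v0: "v0 \<in> ?W" "v0 \<noteq> 0" "H v0 v0 = l * G v0 v0"
    and min: "\<And>v. v \<in> ?W \<Longrightarrow> l * G v v \<le> H v v"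
    using bilinear_rayleigh_quotient_min[OF bilinear bilinear_H W \<open>?W \<noteq> {0}\<close>] pos
    by (metis (no_types, lifting))
  let ?H = "\<lambda>v w. H v w - l * G v w"
  have bH: "bilinear ?H"
    using bilinear bilinear_H unfolding bilinear_def
    by (auto intro!: linear_compose_sub linear_compose_scale_right[where 'b=real, simplified])
  have onW: "?H v0 w = 0" if "w \<in> ?W" for w
    using psd_form_isotropic_imp_radical[OF bH _ W _ v0(1) _ that] min v0(3) sym sym_H by simp
  have onV: "?H v0 w = 0" if "w \<in> ?V" for w
  proof -
    have "H w v0 = 0"
      using that unfolding eigsum_def
    proof (induction w rule: span_induct)
      case base
      show ?case
        by (auto simp: subspace_def bilinear_H bilinear_lzero bilinear_ladd bilinear_lmul)
    next
      case (step x)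
      then obtain k where "x \<in> eigspace k" by blast
      moreover have "G x v0 = 0"
        using v0(1) step by (auto simp: eigsum_def intro: span_base)
      ultimately show ?case by (simp add: eigenspace_wrt_def)
    qed
    moreover have "G w v0 = 0" using v0(1) that by blast
    ultimately show ?thesis by (simp add: sym[of v0] sym_H[of v0])
  qed
  define S where "S = {x + y |x y. x \<in> ?V \<and> y \<in> ?W}"
  have "dim S + dim (?V \<inter> ?W) = dim ?V + dim ?W"
    unfolding S_def by (rule dim_sums_Int[OF V W])
  then have "dim S = DIM('e)"
    using VW ge dim_subset_UNIV[of S] by simp
  then have "span S = UNIV" by (simp only: dim_eq_full)
  moreover have "subspace S"
    unfolding S_def by (rule subspace_sums[OF V W])
  ultimately have S: "S = UNIV" by (metis span_eq_iff)
  then have "?H v0 w = 0" for w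
  proof -
    obtain x y where "w = x + y" "x \<in> ?V" "y \<in> ?W"
      using S unfolding S_def by blast
    then show ?thesis using onV[of x] onW[of y] by (simp only: bilinear_radd[OF bH])
  qed
  then have "v0 \<in> eigspace l" by (auto simp: eigenspace_wrt_def)
  then have "l \<in> eigenvalues_wrt G H" using v0(2) by (auto simp: eigenvalues_wrt_def)
  then have "v0 \<in> ?V"
    using \<open>v0 \<in> eigspace l\<close> by (auto simp: eigsum_def intro: span_base)
  then show False using VW v0 by blast
qed

section \<open>The ordered eigenvalue list and lower bounds for its partial sums\<close>

lemma sorted_eigenvalue_list: "sorted (eigenvalue_list G H)"
  unfolding eigenvalue_list_def by (rule sorted_concat_replicate) simp

lemma length_filter_eigenvalue_list:
  "length (filter P (eigenvalue_list G H)) = dim (eigsum {l \<in> eigenvalues_wrt G H. P l})"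
proof -
  have "length (filter P (eigenvalue_list G H))
      = sum_list (map (\<lambda>l. dim (eigspace l)) (filter P (sorted_list_of_set (eigenvalues_wrt G H))))"
    by (simp add: eigenvalue_list_def length_filter_concat_replicate)
  also have "\<dots> = (\<Sum>l\<in>{l \<in> eigenvalues_wrt G H. P l}. dim (eigspace l))"
    by (subst sum_list_distinct_conv_sum_set) (auto simp: finite_eigenvalues)
  finally show ?thesis by (simp add: dim_eigsum finite_eigenvalues)
qed

lemma length_eigenvalue_list: "length (eigenvalue_list G H) = DIM('e)"
  using length_filter_eigenvalue_list[of "\<lambda>_. True"] eigsum_eigenvalues by simp

text \<open>One half of the Courant-Fischer principle, with positions counted from 0. If entry
  \<open>k\<close> were below \<open>t\<close>, then so would be the first \<open>Suc k\<close>
  entries, and the corresponding eigenspaces would span at least \<open>Suc k\<close> dimensions.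
  Such a space meets \<open>U\<close>, whose codimension is at most \<open>k\<close>, in a nonzero
  vector with \<open>H v v < t * G v v\<close>.\<close>

lemma eigenvalue_list_ge:
  assumes "subspace U" and "\<And>v. v \<in> U \<Longrightarrow> t * G v v \<le> H v v"
    and "DIM('e) \<le> dim U + k" and "k < DIM('e)"
  shows "t \<le> eigenvalue_list G H ! k"
proof (rule ccontr)
  let ?L = "eigenvalue_list G H" and ?V = "eigsum {l \<in> eigenvalues_wrt G H. l < t}"
  assume "\<not> t \<le> ?L ! k"
  then have "\<forall>x \<in> set (take (Suc k) ?L). x < t"
    using sorted_nth_mono[OF sorted_eigenvalue_list] assms(4) length_eigenvalue_list
    by (fastforce simp: in_set_conv_nth less_Suc_eq_le intro: order_le_less_trans)
  then have "Suc k \<le> length (filter (\<lambda>x. x < t) (take (Suc k) ?L))"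
    using assms(4) by (simp add: length_eigenvalue_list filter_True)
  also have "\<dots> \<le> length (filter (\<lambda>x. x < t) ?L)"
    using filter_append[of "\<lambda>x. x < t" "take (Suc k) ?L" "drop (Suc k) ?L"] by simp
  finally have "Suc k \<le> dim ?V" by (simp add: length_filter_eigenvalue_list)
  moreover have "?V \<inter> U = {0}"
  proof -
    have "v = 0" if "v \<in> ?V" "v \<in> U" for v
    proof (rule ccontr)
      assume "v \<noteq> 0"
      have "H v v < t * G v v"
        by (rule eigsum_less[OF _ _ that(1) \<open>v \<noteq> 0\<close>]) (auto simp: finite_eigenvalues)
      then show False using assms(2)[OF that(2)] by linarith
    qed
    then show ?thesis
      using subspace_0[OF assms(1)] by (auto simp: eigsum_def span_zero)
  qed
  moreover have "dim {x + y |x y. x \<in> ?V \<and> y \<in> U} + dim (?V \<inter> U) = dim ?V + dim U"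
    by (rule dim_sums_Int) (auto simp: eigsum_def assms(1))
  moreover have "dim {x + y |x y. x \<in> ?V \<and> y \<in> U} \<le> DIM('e)" by (rule dim_subset_UNIV)
  ultimately show False using assms(3) by simp
qed

lemma Trace_lowest_ge:
  assumes "\<And>v. a * G v v \<le> H v v"
    and "subspace U" and "\<And>v. v \<in> U \<Longrightarrow> t * G v v \<le> H v v"
    and "DIM('e) \<le> dim U + k" and "k < DIM('e)"
  shows "real k * a + t \<le> Trace_lowest (Suc k) G H"
proof -
  let ?L = "eigenvalue_list G H"
  have "a \<le> ?L ! i" if "i < k" for i
    using eigenvalue_list_ge[of UNIV a i] assms(1,5) that by simp
  then have "(\<Sum>i<k. a) \<le> (\<Sum>i<k. ?L ! i)" by (intro sum_mono) simp
  moreover have "t \<le> ?L ! k" using eigenvalue_list_ge assms by blast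
  moreover have "sum_list (take (Suc k) ?L) = (\<Sum>i<Suc k. ?L ! i)"
    using assms(5)
    by (subst sum_list_sum_nth) (simp add: length_eigenvalue_list atLeast0LessThan min.absorb2)
  ultimately show ?thesis by (simp add: Trace_lowest_def)
qed

end

text \<open>Let \<open>a\<close> and \<open>l\<close> be the minima of \<open>H\<close> relative to
  \<open>G\<close> on the whole space and of \<open>P\<close> relative to \<open>G\<close> on
  \<open>U\<close>. Adding \<open>B * P\<close> lowers no eigenvalue bound \<open>a\<close>, while
  \<open>U\<close> has codimension at most \<open>m - 1\<close>, so the \<open>m\<close>-th
  eigenvalue is at least \<open>a + B * l\<close> with \<open>l > 0\<close>.\<close>

lemma Trace_lowest_unbounded:
  fixes G H P :: "'e::euclidean_space \<Rightarrow> 'e \<Rightarrow> real"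
  assumes "inner_form G"
    and H: "bilinear H" "\<And>v w. H v w = H w v"
    and P: "bilinear P" "\<And>v w. P v w = P w v" "\<And>v. 0 \<le> P v v"
    and U: "subspace U" "\<And>v. v \<in> U \<Longrightarrow> v \<noteq> 0 \<Longrightarrow> 0 < P v v"
    and dim: "DIM('e) < dim U + m" "0 < m" "m \<le> DIM('e)"
  obtains B where "0 < B" "K < Trace_lowest m G (\<lambda>v w. H v w + B * P v w)"
proof -
  interpret inner_form G by fact
  obtain k where k: "m = Suc k" using dim(2) by (cases m) auto
  have "U \<noteq> {0}" using dim by auto
  have "(UNIV :: 'e set) \<noteq> {0}" by (metis UNIV_I SOME_Basis nonzero_Basis singletonD)
  obtain a v1 where a: "\<And>v. a * G v v \<le> H v v"
    using bilinear_rayleigh_quotient_min[OF bilinear H(1) subspace_UNIV \<open>UNIV \<noteq> {0}\<close>] pos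
    by (metis UNIV_I)
  obtain l v0 where v0: "v0 \<in> U" "v0 \<noteq> 0" "P v0 v0 = l * G v0 v0"
    and l: "\<And>v. v \<in> U \<Longrightarrow> l * G v v \<le> P v v"
    using bilinear_rayleigh_quotient_min[OF bilinear P(1) U(1) \<open>U \<noteq> {0}\<close>] pos
    by metis
  have "0 < l" using U(2)[OF v0(1,2)] v0(3) pos[OF v0(2)] by (simp add: zero_less_mult_iff)
  \<comment> \<open>Solves \<open>m * a + B * l \<ge> K + 1\<close> for \<open>B\<close>; the
    maximum with 1 keeps \<open>B\<close> positive.\<close>
  define B where "B = max 1 ((K + 1 - real (Suc k) * a) / l)"
  have B: "0 < B" "K < real (Suc k) * a + B * l"
  proof -
    have "(K + 1 - real (Suc k) * a) / l \<le> B" by (simp add: B_def)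
    then have "K + 1 - real (Suc k) * a \<le> B * l" using \<open>0 < l\<close> by (simp add: field_simps)
    then show "K < real (Suc k) * a + B * l" by simp
  qed (simp add: B_def)
  let ?H = "\<lambda>v w. H v w + B * P v w"
  have "bilinear ?H"
    using H(1) P(1) unfolding bilinear_def
    by (auto intro!: linear_compose_add linear_compose_scale_right[where 'b=real, simplified])
  then interpret symmetric_form G ?H
    using H(2) P(2) by unfold_locales auto
  have "real k * a + (a + B * l) \<le> Trace_lowest (Suc k) G ?H"
  proof (rule Trace_lowest_ge)
    show "a * G v v \<le> ?H v v" for v
      using a[of v] P(3)[of v] B(1) by (simp add: add_increasing2)
    show "(a + B * l) * G v v \<le> ?H v v" if "v \<in> U" for v
      unfolding distrib_right mult.assoc
      using a[of v] mult_left_mono[OF l[OF that], of B] B(1) by (intro add_mono) auto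
  qed (use U(1) dim k in auto)
  then have "K < Trace_lowest m G ?H" using B(2) k by (simp add: algebra_simps)
  then show thesis using B(1) that by blast
qed

section \<open>Calculus of \<open>C\<^sup>k\<close> functions\<close>

lemma Ck_on_cong:
  assumes "open S" "\<And>x. x \<in> S \<Longrightarrow> f x = g x" "Ck_on k S f"
  shows "Ck_on k S g"
  using assms(2,3)
proof (induction k arbitrary: f g)
  case 0
  then show ?case by (simp cong: continuous_on_cong)
next
  case (Suc k)
  have D: "(g has_derivative frechet_derivative f (at x)) (at x)" if "x \<in> S" for x
    using Suc.prems that assms(1) has_derivative_transform_within_open[OF _ assms(1) that, of f]
    by (auto simp: frechet_derivative_works)
  then have "frechet_derivative f (at x) = frechet_derivative g (at x)" if "x \<in> S" for x
    using that frechet_derivative_at by blast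
  then have "Ck_on k S (\<lambda>x. frechet_derivative g (at x) v)" for v
    using Suc.IH[of "\<lambda>x. frechet_derivative f (at x) v" "\<lambda>x. frechet_derivative g (at x) v"]
      Suc.prems by simp
  then show ?case using D by (auto simp: differentiable_def)
qed

text \<open>\<open>Ck_on\<close> speaks of \<open>frechet_derivative\<close>; on an open set any
  explicit formula for the derivative may replace it, which the closure properties below rely
  on.\<close>

lemma Ck_on_SucI:
  assumes "open S" "\<And>x. x \<in> S \<Longrightarrow> (f has_derivative D x) (at x)" "\<And>v. Ck_on k S (\<lambda>x. D x v)"
  shows "Ck_on (Suc k) S f"
proof -
  have "D x v = frechet_derivative f (at x) v" if "x \<in> S" for x v
    using assms(2)[OF that] frechet_derivative_at by metis
  then have "Ck_on k S (\<lambda>x. frechet_derivative f (at x) v)" for v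
    by (rule Ck_on_cong[OF assms(1) _ assms(3)])
  then show ?thesis using assms(2) by (auto simp: differentiable_def)
qed

lemma Ck_on_Suc_has_derivative:
  "Ck_on (Suc k) S f \<Longrightarrow> x \<in> S \<Longrightarrow> (f has_derivative frechet_derivative f (at x)) (at x)"
  by (simp add: frechet_derivative_works)

lemma Ck_on_SucD: "Ck_on (Suc k) S f \<Longrightarrow> Ck_on k S f"
proof (induction k arbitrary: f)
  case 0
  then show ?case
    by (auto simp: continuous_on_eq_continuous_within
        intro: differentiable_imp_continuous_within differentiable_at_withinI)
next
  case (Suc k)
  then show ?case by (metis Ck_on.simps(2))
qed

lemma Ck_on_local:
  assumes "\<And>x. x \<in> S \<Longrightarrow> \<exists>U. open U \<and> x \<in> U \<and> Ck_on k U f"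
  shows "Ck_on k S f"
  using assms
proof (induction k arbitrary: f)
  case 0
  then show ?case
    by (meson Ck_on.simps(1) continuous_at_imp_continuous_on continuous_on_eq_continuous_at)
next
  case (Suc k)
  then show ?case by (metis Ck_on.simps(2))
qed

lemma Ck_on_const: "Ck_on k S (\<lambda>_. c)"
  by (induction k arbitrary: c) (auto simp: frechet_derivative_const)

lemma Ck_on_bounded_linear:
  assumes "bounded_linear f"
  shows "Ck_on k S f"
proof (cases k)
  case 0
  then show ?thesis using assms by (simp add: linear_continuous_on)
next
  case (Suc j)
  have "frechet_derivative f (at x) = f" for x
    using assms bounded_linear_imp_has_derivative frechet_derivative_at by metis
  then show ?thesis
    using Suc assms by (auto simp: Ck_on_const intro: bounded_linear_imp_differentiable)
qed

lemma Ck_on_bounded_linear_compose: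
  assumes "open S" "bounded_linear L" "Ck_on k S f"
  shows "Ck_on k S (\<lambda>x. L (f x))"
  using assms(3)
proof (induction k arbitrary: f)
  case 0
  then show ?case using assms(2) by (simp add: bounded_linear.continuous_on)
next
  case (Suc k)
  then show ?case
    by (intro Ck_on_SucI[OF assms(1)
          bounded_linear.has_derivative[OF assms(2) Ck_on_Suc_has_derivative]]) auto
qed

lemma Ck_on_add:
  assumes "open S" "Ck_on k S f" "Ck_on k S g"
  shows "Ck_on k S (\<lambda>x. f x + g x)"
  using assms(2,3)
proof (induction k arbitrary: f g)
  case 0
  then show ?case by (simp add: continuous_on_add)
next
  case (Suc k)
  then show ?case
    by (intro Ck_on_SucI[OF assms(1)
          has_derivative_add[OF Ck_on_Suc_has_derivative Ck_on_Suc_has_derivative]]) auto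
qed

lemma Ck_on_sum:
  assumes "open S" "\<And>i. i \<in> I \<Longrightarrow> Ck_on k S (f i)"
  shows "Ck_on k S (\<lambda>x. \<Sum>i\<in>I. f i x)"
  using assms(2)
  by (induction I rule: infinite_finite_induct) (auto simp: Ck_on_const intro: Ck_on_add assms(1))

lemma Ck_on_scaleR:
  assumes "open S" "Ck_on k S r" "Ck_on k S f"
  shows "Ck_on k S (\<lambda>x. r x *\<^sub>R f x)"
  using assms(2,3)
proof (induction k arbitrary: r f)
  case 0
  then show ?case by (simp add: continuous_on_scaleR)
next
  case (Suc k)
  have "Ck_on k S (\<lambda>x. r x *\<^sub>R frechet_derivative f (at x) v + frechet_derivative r (at x) v *\<^sub>R f x)" for v
    using Suc by (intro Ck_on_add assms(1) Suc.IH) (auto intro: Ck_on_SucD)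
  then show ?case
    using Suc.prems
    by (intro Ck_on_SucI[OF assms(1)
          has_derivative_scaleR[OF Ck_on_Suc_has_derivative Ck_on_Suc_has_derivative]])
qed

lemma Ck_on_mult:
  fixes f g :: "'e::euclidean_space \<Rightarrow> real"
  assumes "open S" "Ck_on k S f" "Ck_on k S g"
  shows "Ck_on k S (\<lambda>x. f x * g x)"
  using Ck_on_scaleR[OF assms] by simp

lemma Ck_on_diff:
  assumes "open S" "Ck_on k S f" "Ck_on k S g"
  shows "Ck_on k S (\<lambda>x. f x - g x)"
  using Ck_on_add[OF assms(1,2) Ck_on_scaleR[OF assms(1) Ck_on_const[of _ _ "-1"] assms(3)]] by simp

lemma Ck_on_power:
  fixes f :: "'e::euclidean_space \<Rightarrow> real"
  assumes "open S" "Ck_on k S f"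
  shows "Ck_on k S (\<lambda>x. f x ^ n)"
  by (induction n) (auto intro: Ck_on_const Ck_on_mult assms)

text \<open>\<open>Ck_on\<close> controls derivatives only in fixed directions, whereas the chain
  rule differentiates \<open>g\<close> in the moving direction
  \<open>frechet_derivative f (at x) v\<close>. Expanding that direction over \<open>Basis\<close>
  leaves a sum of products to which the induction hypothesis applies.\<close>

lemma Ck_on_compose:
  fixes f :: "'e::euclidean_space \<Rightarrow> 'd::euclidean_space" and g :: "'d \<Rightarrow> 'f::real_normed_vector"
  assumes "open S" "f ` S \<subseteq> T" "Ck_on k S f" "Ck_on k T g"
  shows "Ck_on k S (\<lambda>x. g (f x))"
  using assms(3,4)
proof (induction k arbitrary: g)
  case 0
  then show ?case using assms(2) by (simp add: continuous_on_compose2)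
next
  case (Suc k)
  have D: "((\<lambda>x. g (f x)) has_derivative
      (\<lambda>v. \<Sum>b\<in>Basis. (frechet_derivative f (at x) v \<bullet> b) *\<^sub>R frechet_derivative g (at (f x)) b)) (at x)"
    if "x \<in> S" for x
  proof -
    have f': "(f has_derivative frechet_derivative f (at x)) (at x)"
      using Suc.prems that by (simp add: frechet_derivative_works)
    have g': "(g has_derivative frechet_derivative g (at (f x))) (at (f x))"
      using Suc.prems that assms(2) by (auto simp: frechet_derivative_works)
    have "frechet_derivative g (at (f x)) w =
        (\<Sum>b\<in>Basis. (w \<bullet> b) *\<^sub>R frechet_derivative g (at (f x)) b)" for w
      using linear_sum[OF has_derivative_linear[OF g'], of "\<lambda>b. (w \<bullet> b) *\<^sub>R b" Basis]
      by (simp add: euclidean_representation linear_cmul[OF has_derivative_linear[OF g']])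
    then have "(\<lambda>v. frechet_derivative g (at (f x)) (frechet_derivative f (at x) v)) =
        (\<lambda>v. \<Sum>b\<in>Basis. (frechet_derivative f (at x) v \<bullet> b) *\<^sub>R frechet_derivative g (at (f x)) b)"
      by (intro ext)
    then show ?thesis by (rule has_derivative_eq_rhs[OF has_derivative_compose[OF f' g']])
  qed
  show ?case
  proof (rule Ck_on_SucI[OF assms(1) D])
    have "Ck_on k S (\<lambda>x. frechet_derivative g (at (f x)) b)" for b
      using Suc.prems by (intro Suc.IH) (auto intro: Ck_on_SucD)
    moreover have "Ck_on k S (\<lambda>x. frechet_derivative f (at x) v \<bullet> b)" for v b
      using Suc.prems by (intro Ck_on_bounded_linear_compose[OF assms(1) bounded_linear_inner_left]) auto
    ultimately show "Ck_on k S (\<lambda>x. \<Sum>b\<in>Basis. (frechet_derivative f (at x) v \<bullet> b) *\<^sub>R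
        frechet_derivative g (at (f x)) b)" for v
      by (intro Ck_on_sum Ck_on_scaleR assms(1))
  qed
qed

section \<open>Truncated powers and a cutoff function\<close>

lemma has_derivative_pos_part_power:
  "((\<lambda>t::real. max 0 t ^ Suc (Suc n)) has_derivative
    (\<lambda>v. v * (real (Suc (Suc n)) * max 0 x ^ Suc n))) (at x)"
proof -
  have "((\<lambda>t::real. max 0 t ^ Suc (Suc n)) has_real_derivative
      real (Suc (Suc n)) * max 0 x ^ Suc n) (at x)"
  proof (cases "x = 0")
    case True
    have "isCont (\<lambda>h::real. max 0 h ^ Suc n) 0"
      by (intro continuous_intros)
    then have "((\<lambda>h::real. max 0 h ^ Suc n) \<longlongrightarrow> 0) (at 0)"
      by (simp add: isCont_def)
    \<comment> \<open>For \<open>h \<noteq> 0\<close> the difference quotient at 0 is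
      \<open>max 0 h ^ Suc n\<close>.\<close>
    then have "((\<lambda>h::real. max 0 h ^ Suc (Suc n) / h) \<longlongrightarrow> 0) (at 0)"
      by (rule Lim_transform_eventually) (auto simp: eventually_at_filter max_def)
    then show ?thesis using True by (simp add: has_field_derivative_iff)
  next
    case False
    show ?thesis
    proof (cases "x < 0")
      case True
      have "((\<lambda>t::real. 0) has_real_derivative 0) (at x)" by simp
      then have "((\<lambda>t::real. max 0 t ^ Suc (Suc n)) has_real_derivative 0) (at x)"
        by (rule has_field_derivative_transform_within_open[of _ _ _ "{..<0}"]) (use True in auto)
      then show ?thesis using True by (simp add: max_def)
    next
      case nl: False
      have "((\<lambda>t::real. t ^ Suc (Suc n)) has_real_derivative real (Suc (Suc n)) * x ^ Suc n) (at x)"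
        using DERIV_pow[of "Suc (Suc n)" x UNIV] by simp
      then have "((\<lambda>t::real. max 0 t ^ Suc (Suc n)) has_real_derivative real (Suc (Suc n)) * x ^ Suc n) (at x)"
        by (rule has_field_derivative_transform_within_open[of _ _ _ "{0<..}"]) (use False nl in auto)
      then show ?thesis using nl by (simp add: max_def)
    qed
  qed
  then show ?thesis unfolding has_field_derivative_def by (subst mult.commute)
qed

text \<open>Each differentiation lowers the exponent by one, and after \<open>k\<close> of them the
  continuous function \<open>max 0 t\<close> remains.\<close>

lemma Ck_on_pos_part_power: "Ck_on k UNIV (\<lambda>t::real. max 0 t ^ Suc k)"
proof (induction k)
  case 0
  show ?case by (simp add: continuous_intros)
next
  case (Suc k)
  show ?case
    by (rule Ck_on_SucI[OF open_UNIV has_derivative_pos_part_power])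
       (auto intro!: Ck_on_mult Ck_on_const Suc simp del: power_Suc)
qed

text \<open>A cutoff of finite smoothness built from two truncated powers: the inner one vanishes up
  to 1 and reaches 1 at 2, where the outer one becomes 0.\<close>

definition bump :: "nat \<Rightarrow> real \<Rightarrow> real" where
  "bump k t = max 0 (1 - max 0 (t - 1) ^ Suc k) ^ Suc k"

lemma bump_eq_1: "t \<le> 1 \<Longrightarrow> bump k t = 1"
  by (simp add: bump_def max_def)

lemma bump_eq_0: "2 \<le> t \<Longrightarrow> bump k t = 0"
  using one_le_power[of "t - 1" "Suc k"] by (simp add: bump_def max_def)

lemma Ck_on_bump: "Ck_on k UNIV (bump k)"
proof -
  have "Ck_on k UNIV (\<lambda>t::real. t - 1)"
    by (intro Ck_on_diff open_UNIV Ck_on_const Ck_on_bounded_linear bounded_linear_ident)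
  then have "Ck_on k UNIV (\<lambda>t::real. max 0 (t - 1) ^ Suc k)"
    by (rule Ck_on_compose[OF open_UNIV subset_UNIV _ Ck_on_pos_part_power])
  then have "Ck_on k UNIV (\<lambda>t::real. 1 - max 0 (t - 1) ^ Suc k)"
    by (rule Ck_on_diff[OF open_UNIV Ck_on_const])
  then have "Ck_on k UNIV (\<lambda>t::real. max 0 (1 - max 0 (t - 1) ^ Suc k) ^ Suc k)"
    by (rule Ck_on_compose[OF open_UNIV subset_UNIV _ Ck_on_pos_part_power])
  then show ?thesis by (simp add: bump_def[abs_def])
qed

section \<open>Charts\<close>

lemma chart_dom_subset: "is_chart X c \<Longrightarrow> chart_dom c \<subseteq> topspace X"
  by (simp add: is_chart_def openin_subset)

lemma open_chart_img: "is_chart X c \<Longrightarrow> open (chart_img c)"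
  by (simp add: is_chart_def)

lemma inj_on_chart_map:
  assumes "is_chart X c"
  shows "inj_on (chart_map c) (chart_dom c)"
proof -
  have "inj_on (chart_map c) (topspace (subtopology X (chart_dom c)))"
    using assms unfolding is_chart_def by (elim conjE homeomorphic_imp_injective_map)
  then show ?thesis using chart_dom_subset[OF assms] by (simp add: inf.absorb2)
qed

lemma chart_inv_chart_map: "is_chart X c \<Longrightarrow> p \<in> chart_dom c \<Longrightarrow> chart_inv c (chart_map c p) = p"
  by (simp add: chart_inv_def inj_on_chart_map)

lemma chart_inv_in_dom: "x \<in> chart_img c \<Longrightarrow> chart_inv c x \<in> chart_dom c"
  by (simp add: chart_inv_def chart_img_def inv_into_into)

lemma chart_map_chart_inv: "x \<in> chart_img c \<Longrightarrow> chart_map c (chart_inv c x) = x"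
  by (simp add: chart_inv_def chart_img_def f_inv_into_f)

lemma chart_map_in_img: "p \<in> chart_dom c \<Longrightarrow> chart_map c p \<in> chart_img c"
  by (simp add: chart_img_def)

lemma open_chart_map_image:
  assumes "is_chart X c" "openin X V"
  shows "open (chart_map c ` (chart_dom c \<inter> V))"
proof -
  have "open_map (subtopology X (chart_dom c)) (top_of_set (chart_img c)) (chart_map c)"
    using assms(1) homeomorphic_imp_open_map by (auto simp: is_chart_def)
  then have "openin (top_of_set (chart_img c)) (chart_map c ` (chart_dom c \<inter> V))"
    using assms(2) openin_subtopology_Int2[of X V "chart_dom c"] by (auto simp: open_map_def)
  then show ?thesis using open_chart_img[OF assms(1)] openin_open_eq by blast
qed

lemma openin_chart_map_vimage:
  assumes "is_chart X c" "open U"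
  shows "openin X {q \<in> chart_dom c. chart_map c q \<in> U}"
proof -
  have dom: "topspace (subtopology X (chart_dom c)) = chart_dom c"
    using chart_dom_subset[OF assms(1)] by auto
  have "continuous_map (subtopology X (chart_dom c)) (top_of_set (chart_img c)) (chart_map c)"
    using assms(1) homeomorphic_imp_continuous_map by (auto simp: is_chart_def)
  then have "openin (subtopology X (chart_dom c))
      {q \<in> topspace (subtopology X (chart_dom c)). chart_map c q \<in> chart_img c \<inter> U}"
    by (rule openin_continuous_map_preimage) (use assms(2) in \<open>simp add: openin_open_Int\<close>)
  also have "{q \<in> topspace (subtopology X (chart_dom c)). chart_map c q \<in> chart_img c \<inter> U}
      = {q \<in> chart_dom c. chart_map c q \<in> U}"
    unfolding dom by (auto simp: chart_map_in_img)
  finally show ?thesis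
    using assms(1) openin_open_subtopology unfolding is_chart_def by blast
qed

text \<open>On the chart image \<open>chart_inv\<close> agrees with the continuous inverse of the
  homeomorphism, which carries compactness over.\<close>

lemma compactin_chart_inv_image:
  assumes "is_chart X c" "compact K" "K \<subseteq> chart_img c"
  shows "compactin X (chart_inv c ` K)"
proof -
  have "homeomorphic_map (subtopology X (chart_dom c)) (top_of_set (chart_img c)) (chart_map c)"
    using assms(1) by (simp add: is_chart_def)
  then obtain h where h: "homeomorphic_maps (subtopology X (chart_dom c)) (top_of_set (chart_img c)) (chart_map c) h"
    unfolding homeomorphic_map_maps by blast
  have eq: "chart_inv c x = h x" if "x \<in> chart_img c" for x
  proof -
    have "chart_inv c x \<in> topspace (subtopology X (chart_dom c))"
      using chart_inv_in_dom[OF that] chart_dom_subset[OF assms(1)] by auto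
    then have "h (chart_map c (chart_inv c x)) = chart_inv c x"
      using h unfolding homeomorphic_maps_def by blast
    then show ?thesis using chart_map_chart_inv[OF that] by simp
  qed
  have "compactin (top_of_set (chart_img c)) K"
    using assms(2,3) by (simp add: compactin_subtopology)
  moreover have "continuous_map (top_of_set (chart_img c)) (subtopology X (chart_dom c)) h"
    using h by (simp add: homeomorphic_maps_def)
  ultimately have "compactin (subtopology X (chart_dom c)) (h ` K)"
    by (rule image_compactin)
  moreover have "chart_inv c ` K = h ` K"
    using eq assms(3) by (intro image_cong) auto
  ultimately show ?thesis by (simp add: compactin_subtopology)
qed

text \<open>Locally there are two cases. At points of the domain of \<open>d\<close> the function is
  \<open>F\<close> composed with a transition map. At any other point it vanishes nearby, because
  the preimage of \<open>K\<close> is compact, hence closed in a Hausdorff space.\<close>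

lemma Ck_function_extend_by_zero:
  assumes X: "smooth_manifold X A" and d: "d \<in> A"
    and F: "Ck_on k UNIV F" and K: "compact K" "K \<subseteq> chart_img d" and F0: "\<And>x. x \<notin> K \<Longrightarrow> F x = 0"
  shows "Ck_function k A (\<lambda>q. if q \<in> chart_dom d then F (chart_map d q) else 0)"
  unfolding Ck_function_def
proof
  fix c assume c: "c \<in> A"
  let ?f = "\<lambda>q. if q \<in> chart_dom d then F (chart_map d q) else 0"
  have charts: "is_chart X c" "is_chart X d" and X_haus: "Hausdorff_space X"
    and comp: "Ck_compatible k c d"
    using X c d by (auto simp: smooth_manifold_def)
  show "Ck_on k (chart_img c) (?f \<circ> chart_inv c)"
  proof (rule Ck_on_local)
    fix x assume x: "x \<in> chart_img c"
    let ?q = "chart_inv c x"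
    have q: "?q \<in> chart_dom c" "chart_map c ?q = x"
      using x by (simp_all add: chart_inv_in_dom chart_map_chart_inv)
    show "\<exists>U. open U \<and> x \<in> U \<and> Ck_on k U (?f \<circ> chart_inv c)"
    proof (cases "?q \<in> chart_dom d")
      case True
      let ?U = "chart_map c ` (chart_dom c \<inter> chart_dom d)"
      have U: "open ?U"
        using open_chart_map_image[OF charts(1)] charts(2) unfolding is_chart_def by blast
      have "Ck_on k ?U (\<lambda>x. F (transition c d x))"
        by (rule Ck_on_compose[OF U subset_UNIV _ F]) (use comp in \<open>simp add: Ck_compatible_def\<close>)
      then have "Ck_on k ?U (?f \<circ> chart_inv c)"
        by (rule Ck_on_cong[OF U, rotated])
           (auto simp: transition_def chart_inv_chart_map[OF charts(1)])
      moreover have "x \<in> ?U" using True q by (metis IntI imageI)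
      ultimately show ?thesis using U by blast
    next
      case False
      let ?L = "chart_inv d ` K"
      let ?U = "chart_map c ` (chart_dom c \<inter> (topspace X - ?L))"
      have "closedin X ?L"
        using compactin_chart_inv_image[OF charts(2) K] compactin_imp_closedin X_haus by blast
      then have U: "open ?U"
        by (intro open_chart_map_image[OF charts(1)] openin_diff) auto
      have "?q \<notin> ?L" using False K(2) chart_inv_in_dom[of _ d] by auto
      then have "x \<in> ?U"
        using q chart_dom_subset[OF charts(1)] by (metis DiffI IntI imageI subsetD)
      moreover have "Ck_on k ?U (?f \<circ> chart_inv c)"
      proof (rule Ck_on_cong[OF U _ Ck_on_const[of k ?U 0]])
        fix y assume "y \<in> ?U"
        then obtain r where r: "r \<in> chart_dom c" "r \<notin> ?L" "y = chart_map c r" by blast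
        have "chart_map d r \<notin> K" if "r \<in> chart_dom d"
          using r(2) chart_inv_chart_map[OF charts(2) that] by (metis imageI)
        then show "0 = (?f \<circ> chart_inv c) y"
          using F0 r by (simp add: chart_inv_chart_map[OF charts(1)])
      qed
      ultimately show ?thesis using U by blast
    qed
  qed
qed

section \<open>The Levi-Civita connection at a point\<close>

lemma inner_form_metric:
  assumes "Ck_riemannian_metric k A g" "c \<in> A" "p \<in> chart_dom c"
  shows "inner_form (g c p)"
proof -
  have "bilinear (g c p) \<and> (\<forall>v w. g c p v w = g c p w v) \<and> (\<forall>v. v \<noteq> 0 \<longrightarrow> g c p v v > 0)"
    using bspec[OF bspec[OF conjunct1[OF assms(1)[unfolded Ck_riemannian_metric_def]] assms(2)] assms(3)] .
  then show ?thesis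
    unfolding inner_form_def by (elim conjE) (intro conjI; assumption)
qed

context
  fixes X :: "'a topology" and A :: "('a, 'e::euclidean_space) chart set"
    and g :: "('a, 'e) metric_components" and c p
  assumes g: "Ck_riemannian_metric 1 A g" and c: "c \<in> A" "is_chart X c" and p: "p \<in> chart_dom c"
begin

lemma has_derivative_metric:
  "((\<lambda>x. g c (chart_inv c x) v w) has_derivative (\<lambda>u. metric_deriv g c p u v w)) (at (chart_map c p))"
proof -
  have "Ck_on (Suc 0) (chart_img c) (\<lambda>x. g c (chart_inv c x) v w)"
    using g c(1) unfolding Ck_riemannian_metric_def One_nat_def by blast
  then show ?thesis
    unfolding metric_deriv_def by (rule Ck_on_Suc_has_derivative[OF _ chart_map_in_img[OF p]])
qed

text \<open>By uniqueness of the derivative, identities between metric components valid throughout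
  the chart domain pass to \<open>metric_deriv\<close>; symmetry and linearity follow from
  this.\<close>

lemma metric_deriv_eqI:
  assumes "((\<lambda>x. F x) has_derivative F') (at (chart_map c p))"
    and "\<And>q. q \<in> chart_dom c \<Longrightarrow> g c q v w = F (chart_map c q)"
  shows "metric_deriv g c p u v w = F' u"
proof -
  have "((\<lambda>x. g c (chart_inv c x) v w) has_derivative F') (at (chart_map c p))"
    using assms(1)
  proof (rule has_derivative_transform_within_open[OF _ open_chart_img[OF c(2)] chart_map_in_img[OF p]])
    show "F x = g c (chart_inv c x) v w" if "x \<in> chart_img c" for x
      using assms(2)[OF chart_inv_in_dom[OF that]] chart_map_chart_inv[OF that] by simp
  qed
  then show ?thesis using has_derivative_metric has_derivative_unique by metis
qed

lemma metric_form:
  assumes "q \<in> chart_dom c"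
  shows "bilinear (g c q)" "g c q v w = g c q w v"
  by (rule inner_form.bilinear[OF inner_form_metric[OF g c(1) assms]])
     (rule inner_form.sym[OF inner_form_metric[OF g c(1) assms]])

lemma metric_deriv_sym: "metric_deriv g c p u v w = metric_deriv g c p u w v"
  by (rule metric_deriv_eqI[OF has_derivative_metric])
     (simp add: chart_inv_chart_map[OF c(2)], rule metric_form(2))

lemma linear_metric_deriv1: "linear (\<lambda>u. metric_deriv g c p u v w)"
  by (rule has_derivative_linear[OF has_derivative_metric])

lemma linear_metric_deriv2: "linear (\<lambda>v. metric_deriv g c p u v w)"
proof (rule linearI)
  fix v v' :: 'e and r :: real
  let ?G = "\<lambda>v x. g c (chart_inv c x) v w" and ?D = "\<lambda>v u. metric_deriv g c p u v w"
  have "g c q (v + v') w = ?G v (chart_map c q) + ?G v' (chart_map c q)"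
    if "q \<in> chart_dom c" for q
    using bilinear_ladd[OF metric_form(1)[OF that]] chart_inv_chart_map[OF c(2) that] by simp
  then show "metric_deriv g c p u (v + v') w = metric_deriv g c p u v w + metric_deriv g c p u v' w"
    by (rule metric_deriv_eqI[where F' = "\<lambda>u. ?D v u + ?D v' u",
          OF has_derivative_add[OF has_derivative_metric has_derivative_metric]])
  have "g c q (r *\<^sub>R v) w = r *\<^sub>R ?G v (chart_map c q)" if "q \<in> chart_dom c" for q
    using bilinear_lmul[OF metric_form(1)[OF that]] chart_inv_chart_map[OF c(2) that] by simp
  then show "metric_deriv g c p u (r *\<^sub>R v) w = r *\<^sub>R metric_deriv g c p u v w"
    by (rule metric_deriv_eqI[where F' = "\<lambda>u. r *\<^sub>R ?D v u",
          OF has_derivative_scaleR_right[OF has_derivative_metric]])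
qed

lemma linear_metric_deriv3: "linear (\<lambda>w. metric_deriv g c p u v w)"
proof -
  have "metric_deriv g c p u v = (\<lambda>w. metric_deriv g c p u w v)"
    by (rule ext) (rule metric_deriv_sym)
  then show ?thesis using linear_metric_deriv2[of u v] by simp
qed

lemmas metric_deriv_linear =
  linear_add[OF linear_metric_deriv1] linear_add[OF linear_metric_deriv2]
  linear_add[OF linear_metric_deriv3] linear_cmul[OF linear_metric_deriv1]
  linear_cmul[OF linear_metric_deriv2] linear_cmul[OF linear_metric_deriv3]

lemma metric_christoffel:
  "g c p (christoffel g c p v w) z
    = (metric_deriv g c p v w z + metric_deriv g c p w v z - metric_deriv g c p z v w) / 2"
proof -
  interpret inner_form "g c p" by (rule inner_form_metric[OF g c(1) p])
  have "linear (\<lambda>z. (metric_deriv g c p v w z + metric_deriv g c p w v z - metric_deriv g c p z v w) / 2)"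
    by (rule linearI) (simp_all add: metric_deriv_linear field_simps)
  from theI'[OF representation[OF this]] show ?thesis
    unfolding christoffel_def by (rule spec)
qed

lemma christoffel_eqI:
  assumes "\<And>z. g c p u z
    = (metric_deriv g c p v w z + metric_deriv g c p w v z - metric_deriv g c p z v w) / 2"
  shows "christoffel g c p v w = u"
proof -
  interpret inner_form "g c p" by (rule inner_form_metric[OF g c(1) p])
  have "g c p (christoffel g c p v w - u) (christoffel g c p v w - u) = 0"
    by (simp add: bilinear_lsub[OF bilinear] metric_christoffel assms)
  then show ?thesis by (simp add: eq_0_iff)
qed

lemma christoffel_sym: "christoffel g c p v w = christoffel g c p w v"
proof (rule christoffel_eqI)
  fix z
  show "g c p (christoffel g c p w v) z
    = (metric_deriv g c p v w z + metric_deriv g c p w v z - metric_deriv g c p z v w) / 2"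
    using metric_christoffel[of w v z] metric_deriv_sym[of z w v] by (simp add: add.commute)
qed

text \<open>Each linearity identity is checked after pairing with an arbitrary \<open>z\<close>.
  Together with symmetry it makes the Hessian of the test function a symmetric form, as the
  eigenvalue theory requires.\<close>

lemma bilinear_christoffel: "bilinear (christoffel g c p)"
proof -
  interpret inner_form "g c p" by (rule inner_form_metric[OF g c(1) p])
  have *: "linear (\<lambda>v. christoffel g c p v w)" for w
  proof (rule linearI)
    show "christoffel g c p (v + v') w = christoffel g c p v w + christoffel g c p v' w" for v v'
      by (rule christoffel_eqI)
         (simp add: bilinear_ladd[OF bilinear] metric_christoffel metric_deriv_linear
           add_divide_distrib diff_divide_distrib)
    show "christoffel g c p (r *\<^sub>R v) w = r *\<^sub>R christoffel g c p v w" for r v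
      by (rule christoffel_eqI)
         (simp add: bilinear_lmul[OF bilinear] metric_christoffel metric_deriv_linear
           distrib_left right_diff_distrib)
  qed
  moreover have "linear (\<lambda>w. christoffel g c p v w)" for v
  proof -
    have "christoffel g c p v = (\<lambda>w. christoffel g c p w v)"
      by (rule ext) (rule christoffel_sym)
    then show ?thesis using *[of v] by simp
  qed
  ultimately show ?thesis by (simp add: bilinear_def)
qed

end

section \<open>The quadratic test function\<close>

lemma has_derivative_inner_quadratic:
  fixes a e x :: "'e::euclidean_space"
  shows "((\<lambda>x. (x - a) \<bullet> e - (x - a) \<bullet> (x - a) + B * (\<Sum>b\<in>I. ((x - a) \<bullet> b)\<^sup>2)) has_derivative
    (\<lambda>w. w \<bullet> e - 2 * ((x - a) \<bullet> w) + B * (\<Sum>b\<in>I. 2 * ((x - a) \<bullet> b) * (w \<bullet> b)))) (at x)"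
  by (auto intro!: derivative_eq_intros simp: inner_commute algebra_simps power2_eq_square
      sum_distrib_left intro!: ext sum.cong)

lemma frechet_derivative_inner_quadratic:
  fixes a e x :: "'e::euclidean_space"
  shows "frechet_derivative
    (\<lambda>x. (x - a) \<bullet> e - (x - a) \<bullet> (x - a) + B * (\<Sum>b\<in>I. ((x - a) \<bullet> b)\<^sup>2)) (at x) w =
     w \<bullet> e - 2 * ((x - a) \<bullet> w) + B * (\<Sum>b\<in>I. 2 * ((x - a) \<bullet> b) * (w \<bullet> b))"
  by (simp only: frechet_derivative_at[OF has_derivative_inner_quadratic, symmetric])

lemma frechet_derivative2_inner_quadratic:
  fixes a e x v w :: "'e::euclidean_space"
  shows "frechet_derivative
    (\<lambda>x. w \<bullet> e - 2 * ((x - a) \<bullet> w) + B * (\<Sum>b\<in>I. 2 * ((x - a) \<bullet> b) * (w \<bullet> b))) (at x) v =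
     - 2 * (v \<bullet> w) + B * (\<Sum>b\<in>I. 2 * (v \<bullet> b) * (w \<bullet> b))"
proof -
  have "((\<lambda>x. w \<bullet> e - 2 * ((x - a) \<bullet> w) + B * (\<Sum>b\<in>I. 2 * ((x - a) \<bullet> b) * (w \<bullet> b))) has_derivative
    (\<lambda>v. - 2 * (v \<bullet> w) + B * (\<Sum>b\<in>I. 2 * (v \<bullet> b) * (w \<bullet> b)))) (at x)"
    by (auto intro!: derivative_eq_intros)
  from frechet_derivative_at[OF this, symmetric] show ?thesis by simp
qed

lemma Ck_on_inner_quadratic:
  fixes a e :: "'e::euclidean_space"
  shows "Ck_on k UNIV (\<lambda>x. (x - a) \<bullet> e - (x - a) \<bullet> (x - a) + B * (\<Sum>b\<in>I. ((x - a) \<bullet> b)\<^sup>2))"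
    and "Ck_on k UNIV (\<lambda>x. (x - a) \<bullet> (x - a))"
proof -
  have id: "Ck_on k UNIV (\<lambda>x::'e. x - a)"
    by (intro Ck_on_diff open_UNIV Ck_on_const Ck_on_bounded_linear bounded_linear_ident)
  have lin: "Ck_on k UNIV (\<lambda>x. (x - a) \<bullet> b)" for b
    by (rule Ck_on_bounded_linear_compose[OF open_UNIV bounded_linear_inner_left id])
  have "(x - a) \<bullet> (x - a) = (\<Sum>b\<in>Basis. ((x - a) \<bullet> b)\<^sup>2)" for x
    by (subst euclidean_inner) (simp add: power2_eq_square)
  then have "(\<lambda>x. (x - a) \<bullet> (x - a)) = (\<lambda>x. \<Sum>b\<in>Basis. ((x - a) \<bullet> b)\<^sup>2)" by (rule ext)
  then show sq: "Ck_on k UNIV (\<lambda>x. (x - a) \<bullet> (x - a))"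
    by (simp only:) (intro Ck_on_sum Ck_on_power open_UNIV lin)
  show "Ck_on k UNIV (\<lambda>x. (x - a) \<bullet> e - (x - a) \<bullet> (x - a) + B * (\<Sum>b\<in>I. ((x - a) \<bullet> b)\<^sup>2))"
    by (intro Ck_on_add Ck_on_diff Ck_on_mult Ck_on_const Ck_on_sum Ck_on_power open_UNIV lin sq)
qed

text \<open>Since \<open>e\<close> is not orthogonal to \<open>T\<close>, it lies outside the
  complement spanned by the orthonormal basis \<open>N\<close>. Adding \<open>e\<close> to
  \<open>N\<close> therefore gains one dimension, leaving codimension
  \<open>dim T - 1\<close>.\<close>

lemma transversal_frame:
  fixes T :: "'e::euclidean_space set"
  assumes T: "subspace T" and t: "t \<in> T" "t \<bullet> e \<noteq> 0"
  obtains N where "finite N" "e \<notin> N" "\<And>b. b \<in> N \<Longrightarrow> norm b = 1"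
    "\<And>b s. b \<in> N \<Longrightarrow> s \<in> T \<Longrightarrow> s \<bullet> b = 0" "dim (span (insert e N)) + dim T = Suc DIM('e)"
proof -
  let ?Tp = "{y \<in> UNIV. \<forall>x\<in>T. orthogonal x y}"
  have dimTp: "dim ?Tp + dim T = DIM('e)"
    using dim_subspace_orthogonal_to_vectors[OF T subspace_UNIV] by simp
  have Tp: "subspace ?Tp"
    using subspace_orthogonal_to_vectors by simp
  obtain N where N: "N \<subseteq> ?Tp" "pairwise orthogonal N" "\<And>x. x \<in> N \<Longrightarrow> norm x = 1"
    "independent N" "card N = dim ?Tp" "span N = ?Tp"
    using orthonormal_basis_subspace[OF Tp] by blast
  have fin: "finite N" using N(4) independent_imp_finite by blast
  have e: "e \<notin> span N" using t N(6) by (auto simp: orthogonal_def)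
  then have "e \<notin> N" using span_base by blast
  moreover have "independent (insert e N)" using e N(4) by (simp add: independent_insertI)
  then have "dim (span (insert e N)) = card (insert e N)"
    by (simp add: dim_eq_card_independent)
  ultimately show thesis
    using that[of N] fin N(1,3,5) dimTp by (auto simp: orthogonal_def)
qed

lemma inner_sum_pos_on_span:
  fixes I :: "'e::euclidean_space set"
  assumes "finite I" "v \<in> span I" "v \<noteq> 0"
  shows "0 < (\<Sum>b\<in>I. (v \<bullet> b)\<^sup>2)"
proof (rule ccontr)
  assume "\<not> ?thesis"
  then have "(\<Sum>b\<in>I. (v \<bullet> b)\<^sup>2) = 0" 
    by (simp add: antisym sum_nonneg not_less)
  then have "\<forall>b\<in>I. v \<bullet> b = 0" using assms(1) by (simp add: sum_nonneg_eq_0_iff)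
  then have "orthogonal v v"
    using assms(2) orthogonal_to_span[of v I v] by (simp add: orthogonal_def)
  then show False using assms(3) by (simp add: orthogonal_self)
qed

text \<open>The points \<open>z\<close> lie outside the ball around \<open>a + e\<close> that touches \<open>a\<close>, which controls the
  linear term, and almost in \<open>a + T\<close>, which makes the terms with \<open>b \<in> N\<close> negligible.\<close>

lemma inner_quadratic_nonpos_near:
  fixes a e :: "'e::euclidean_space"
  assumes N: "finite N" "e \<notin> N" "\<And>b. b \<in> N \<Longrightarrow> norm b = 1" "\<And>b s. b \<in> N \<Longrightarrow> s \<in> T \<Longrightarrow> s \<bullet> b = 0"
    and ball: "\<And>z. z \<in> W \<Longrightarrow> norm e \<le> norm (z - (a + e))"
    and tangent: "\<And>\<epsilon>. 0 < \<epsilon> \<Longrightarrow> \<exists>\<delta>>0. \<forall>z\<in>W. norm (z - a) < \<delta> \<longrightarrow>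
      (\<exists>s\<in>T. norm (z - a - s) \<le> \<epsilon> * norm (z - a))"
    and B: "0 < B"
  shows "\<exists>\<delta>>0. \<forall>z\<in>W. norm (z - a) < \<delta> \<longrightarrow>
    (z - a) \<bullet> e - (z - a) \<bullet> (z - a) + B * (\<Sum>b\<in>insert e N. ((z - a) \<bullet> b)\<^sup>2) \<le> 0"
proof -
  \<comment> \<open>Makes \<open>B * card N * \<epsilon>\<^sup>2\<close> at most 1/4; the added 1
    covers an empty \<open>N\<close>.\<close>
  define \<epsilon> where "\<epsilon> = sqrt (1 / (4 * B * (real (card N) + 1)))"
  have \<epsilon>: "0 < \<epsilon>" "\<epsilon>\<^sup>2 = 1 / (4 * B * (real (card N) + 1))" using B by (simp_all add: \<epsilon>_def)
  obtain \<delta> where \<delta>: "0 < \<delta>" and tan: "\<And>z. z \<in> W \<Longrightarrow> norm (z - a) < \<delta> \<Longrightarrow>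
      \<exists>s\<in>T. norm (z - a - s) \<le> \<epsilon> * norm (z - a)"
    using tangent[OF \<epsilon>(1)] by blast
  \<comment> \<open>The second bound forces \<open>B * \<bar>u \<bullet> e\<bar> \<le> 1 / 2\<close>
    by Cauchy-Schwarz, so that the quadratic term in \<open>e\<close> is dominated by the linear
    one.\<close>
  let ?\<delta> = "min \<delta> (1 / (2 * B * (norm e + 1)))"
  show ?thesis
  proof (intro exI conjI ballI impI)
    show "0 < ?\<delta>" using \<delta> B by (simp add: add_nonneg_pos)
    fix z assume z: "z \<in> W" "norm (z - a) < ?\<delta>"
    define u s where "u = z - a" and "s = u \<bullet> e"
    obtain r where r: "r \<in> T" "norm (u - r) \<le> \<epsilon> * norm u"
      using tan[OF z(1)] z(2) by (auto simp: u_def)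
    have "(u \<bullet> b)\<^sup>2 \<le> \<epsilon>\<^sup>2 * (norm u)\<^sup>2" if b: "b \<in> N" for b
    proof -
      have "u \<bullet> b = (u - r) \<bullet> b" using N(4)[OF b r(1)] by (simp add: inner_diff_left)
      also have "\<bar>\<dots>\<bar> \<le> norm (u - r) * norm b" by (rule Cauchy_Schwarz_ineq2)
      finally have "\<bar>u \<bullet> b\<bar> \<le> \<epsilon> * norm u" using r(2) N(3)[OF b] by simp
      then have "\<bar>u \<bullet> b\<bar>\<^sup>2 \<le> (\<epsilon> * norm u)\<^sup>2" by (rule power_mono) simp
      then show ?thesis by (simp add: power_mult_distrib)
    qed
    then have "(\<Sum>b\<in>N. (u \<bullet> b)\<^sup>2) \<le> real (card N) * (\<epsilon>\<^sup>2 * (norm u)\<^sup>2)"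
      by (rule sum_bounded_above)
    then have "B * (\<Sum>b\<in>N. (u \<bullet> b)\<^sup>2) \<le> B * (real (card N) * (\<epsilon>\<^sup>2 * (norm u)\<^sup>2))"
      using B by (intro mult_left_mono) auto
    also have "\<dots> = (real (card N) / (4 * (real (card N) + 1))) * (norm u)\<^sup>2"
    proof -
      have "B * (n * (1 / (4 * B * c) * y)) = n / (4 * c) * y" if "0 < c" for n c y :: real
        using B that by (simp add: field_simps)
      then show ?thesis unfolding \<epsilon>(2) by simp
    qed
    also have "\<dots> \<le> (1 / 4) * (norm u)\<^sup>2"
      by (intro mult_right_mono) (auto simp: field_simps)
    finally have normal: "B * (\<Sum>b\<in>N. (u \<bullet> b)\<^sup>2) \<le> (norm u)\<^sup>2 / 4" by simp
    \<comment> \<open>Expanding the square turns the ball condition into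
      \<open>2 * (u \<bullet> e) \<le> \<bar>u\<bar>\<^sup>2\<close>.\<close>
    have "(norm e)\<^sup>2 \<le> (norm (u - e))\<^sup>2"
      using ball[OF z(1)] by (intro power_mono) (simp_all add: u_def algebra_simps)
    then have s: "2 * s \<le> (norm u)\<^sup>2"
      by (simp add: s_def power2_norm_eq_inner inner_diff_left inner_diff_right inner_commute)
    have "\<bar>s\<bar> \<le> norm u * norm e" unfolding s_def by (rule Cauchy_Schwarz_ineq2)
    also have "\<dots> \<le> norm u * (norm e + 1)" by (intro mult_left_mono) auto
    also have "\<dots> \<le> 1 / (2 * B * (norm e + 1)) * (norm e + 1)"
      using z(2) by (intro mult_right_mono) (auto simp: u_def)
    also have "\<dots> = 1 / (2 * B)"
    proof -
      have "norm e + 1 \<noteq> 0" using norm_ge_zero[of e] by linarith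
      then show ?thesis using B by simp
    qed
    finally have Bs: "B * \<bar>s\<bar> \<le> 1 / 2" using B by (simp add: field_simps)
    \<comment> \<open>The term \<open>- u \<bullet> u\<close> pays for 1/4 from the normal
      directions and 3/4 from here. For positive \<open>s\<close> the left side is at most
      \<open>3 / 2 * s\<close>; otherwise it is \<open>s\<close> times the positive factor
      \<open>1 + B * s\<close>.\<close>
    have tangential: "s + B * s\<^sup>2 \<le> 3 / 4 * (norm u)\<^sup>2"
    proof (cases "s \<le> 0")
      case True
      have "s + B * s\<^sup>2 = s * (1 + B * s)" by (simp add: power2_eq_square algebra_simps)
      also have "\<dots> \<le> 0" using True Bs by (intro mult_nonpos_nonneg) auto
      finally show ?thesis by (rule order_trans) simp
    next
      case False
      have "B * s\<^sup>2 = (B * \<bar>s\<bar>) * s" using False by (simp add: power2_eq_square)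
      also have "\<dots> \<le> 1 / 2 * s" using False Bs by (intro mult_right_mono) auto
      finally show ?thesis using s by simp
    qed
    have "(\<Sum>b\<in>insert e N. (u \<bullet> b)\<^sup>2) = s\<^sup>2 + (\<Sum>b\<in>N. (u \<bullet> b)\<^sup>2)"
      using N(1,2) by (simp add: s_def)
    then have "s - u \<bullet> u + B * (\<Sum>b\<in>insert e N. (u \<bullet> b)\<^sup>2) \<le> 0"
      using normal tangential by (simp add: distrib_left power2_norm_eq_inner)
    then show "(z - a) \<bullet> e - (z - a) \<bullet> (z - a) + B * (\<Sum>b\<in>insert e N. ((z - a) \<bullet> b)\<^sup>2) \<le> 0"
      unfolding s_def u_def .
  qed
qed

section \<open>The touching point\<close>

text \<open>The contradiction at the touching point. The submanifold enters only through
  \<open>T\<close>, which approximates \<open>Z\<close> to first order at \<open>p\<close> and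
  contains a vector not orthogonal to \<open>e\<close>.\<close>

lemma mh_subset_no_inner_touching:
  fixes X :: "'a topology" and A :: "('a, 'e::euclidean_space) chart set"
  assumes X: "smooth_manifold X A" and g: "Ck_riemannian_metric 1 A g"
    and Z: "mh_subset X A g m h Z"
    and d: "d \<in> A" and p: "p \<in> Z" "p \<in> V" and V: "openin X V" "V \<subseteq> chart_dom d"
    and T: "subspace T" "dim T = m" "t \<in> T" "t \<bullet> e \<noteq> 0"
    and ball: "\<And>z. z \<in> Z \<inter> V \<Longrightarrow> norm e \<le> norm (chart_map d z - (chart_map d p + e))"
    and tangent: "\<And>\<epsilon>. 0 < \<epsilon> \<Longrightarrow> \<exists>\<delta>>0. \<forall>z\<in>Z \<inter> V. norm (chart_map d z - chart_map d p) < \<delta> \<longrightarrow>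
      (\<exists>s\<in>T. norm (chart_map d z - chart_map d p - s) \<le> \<epsilon> * norm (chart_map d z - chart_map d p))"
  shows False
proof -
  have chart: "is_chart X d" using X d by (simp add: smooth_manifold_def)
  have pd: "p \<in> chart_dom d" using p V by blast
  define a where "a = chart_map d p"
  let ?W = "chart_map d ` (Z \<inter> V)" and ?G = "g d p"
  obtain N where N: "finite N" "e \<notin> N" "\<And>b. b \<in> N \<Longrightarrow> norm b = 1"
    "\<And>b s. b \<in> N \<Longrightarrow> s \<in> T \<Longrightarrow> s \<bullet> b = 0" "dim (span (insert e N)) + dim T = Suc DIM('e)"
    using transversal_frame[OF T(1,3,4)] by blast
  let ?I = "insert e N"
  \<comment> \<open>The Hessian of the test function at \<open>p\<close> will be
    \<open>?H + B * ?P\<close>. The Christoffel term belongs to \<open>?H\<close> because it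
    involves only the derivative at \<open>p\<close>, which is \<open>v \<bullet> e\<close> for
    every \<open>B\<close>.\<close>
  let ?H = "\<lambda>v w. - 2 * (v \<bullet> w) - christoffel g d p v w \<bullet> e"
  let ?P = "\<lambda>v w::'e. \<Sum>b\<in>?I. 2 * (v \<bullet> b) * (w \<bullet> b)"
  note christ = bilinear_christoffel[OF g d chart pd] christoffel_sym[OF g d chart pd]
  have "t \<noteq> 0" using T(4) by auto
  then have "dim T \<noteq> 0" using T(3) unfolding dim_eq_0 by blast
  then have "0 < m" using T(2) by linarith
  have bH: "bilinear ?H"
    unfolding bilinear_def
    by (intro conjI allI linearI)
       (simp_all add: bilinear_ladd[OF christ(1)] bilinear_radd[OF christ(1)] bilinear_lmul[OF christ(1)]
         bilinear_rmul[OF christ(1)] inner_add_left inner_add_right algebra_simps)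
  have sH: "?H v w = ?H w v" for v w
    using christ(2)[of v w] by (simp add: inner_commute)
  have bP: "bilinear ?P"
    unfolding bilinear_def
    by (intro conjI allI linearI)
       (simp_all add: inner_add_left algebra_simps sum.distrib sum_distrib_left del: sum.insert)
  have sP: "?P v w = ?P w v" for v w
    by (intro sum.cong) (simp_all add: mult.commute mult.left_commute)
  have Pvv: "?P v v = 2 * (\<Sum>b\<in>?I. (v \<bullet> b)\<^sup>2)" for v
    by (simp only: sum_distrib_left power2_eq_square mult.assoc)
  have dim: "DIM('e) < dim (span ?I) + m" "m \<le> DIM('e)"
    using N(5) T(2) dim_subset_UNIV[of T] by linarith+
  \<comment> \<open>The threshold is the right side of the \<open>mh_subset\<close> inequality for
    the test function; it is independent of \<open>B\<close>, so it can be fixed before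
    \<open>B\<close> is chosen.\<close>
  obtain B where B: "0 < B"
    and trace: "h * dual_norm ?G (\<lambda>v. v \<bullet> e) < Trace_lowest m ?G (\<lambda>v w. ?H v w + B * ?P v w)"
  proof (rule Trace_lowest_unbounded[OF inner_form_metric[OF g d pd] bH sH bP sP _ subspace_span _ dim(1) \<open>0 < m\<close> dim(2)])
    show "0 \<le> ?P v v" for v unfolding Pvv by (intro mult_nonneg_nonneg sum_nonneg) auto
    show "0 < ?P v v" if "v \<in> span ?I" "v \<noteq> 0" for v
      using inner_sum_pos_on_span[OF _ that] N(1) unfolding Pvv by simp
  qed blast
  let ?Q = "\<lambda>x. (x - a) \<bullet> e - (x - a) \<bullet> (x - a) + B * (\<Sum>b\<in>?I. ((x - a) \<bullet> b)\<^sup>2)"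
  have "\<exists>\<delta>>0. \<forall>z\<in>?W. norm (z - a) < \<delta> \<longrightarrow> ?Q z \<le> 0"
  proof (rule inner_quadratic_nonpos_near[OF N(1-4) _ _ B])
    show "norm e \<le> norm (z - (a + e))" if "z \<in> ?W" for z
      using that ball by (auto simp: a_def)
    show "\<exists>\<delta>>0. \<forall>z\<in>?W. norm (z - a) < \<delta> \<longrightarrow> (\<exists>s\<in>T. norm (z - a - s) \<le> \<epsilon> * norm (z - a))"
      if "0 < \<epsilon>" for \<epsilon> :: real
      using tangent[OF that] by (simp add: a_def)
  qed
  then obtain \<delta> where \<delta>: "0 < \<delta>" "\<And>z. z \<in> ?W \<Longrightarrow> norm (z - a) < \<delta> \<Longrightarrow> ?Q z \<le> 0" by blast
  have "a \<in> chart_img d" by (simp add: a_def chart_map_in_img pd)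
  then obtain r where r: "0 < r" "cball a r \<subseteq> chart_img d"
    using open_chart_img[OF chart] open_contains_cball by blast
  define s where "s = r / 2"
  have s: "0 < s" "cball a (2 * s) \<subseteq> chart_img d" using r by (simp_all add: s_def)
  \<comment> \<open>The cutoff is 1 for \<open>\<bar>x - a\<bar> \<le> s\<close>, and 0 for
    \<open>\<bar>x - a\<bar> \<ge> 2 * s\<close>; the closed ball of radius \<open>2 * s\<close>
    lies in the chart image, so extension by zero applies.\<close>
  let ?F = "\<lambda>x. bump 2 (1 / s\<^sup>2 * ((x - a) \<bullet> (x - a))) * ?Q x"
  let ?f = "\<lambda>q. if q \<in> chart_dom d then ?F (chart_map d q) else 0"
  have "Ck_function 2 A ?f"
  proof (rule Ck_function_extend_by_zero[OF X d _ compact_cball s(2)])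
    have "Ck_on 2 UNIV (\<lambda>x. 1 / s\<^sup>2 * ((x - a) \<bullet> (x - a)))"
      by (intro Ck_on_mult open_UNIV Ck_on_const Ck_on_inner_quadratic)
    from Ck_on_compose[OF open_UNIV subset_UNIV this Ck_on_bump]
    show "Ck_on 2 UNIV ?F"
      by (intro Ck_on_mult open_UNIV Ck_on_inner_quadratic)
    show "?F x = 0" if "x \<notin> cball a (2 * s)" for x
    proof -
      have "2 * s < norm (x - a)" using that by (simp add: dist_norm norm_minus_commute)
      then have "(2 * s)\<^sup>2 \<le> (norm (x - a))\<^sup>2" using s(1) by (intro power_mono) auto
      moreover have "(2 * s)\<^sup>2 = 4 * s\<^sup>2" by (simp add: power2_eq_square)
      ultimately have "2 * s\<^sup>2 \<le> (norm (x - a))\<^sup>2" using zero_le_power2[of s] by linarith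
      then have "2 \<le> 1 / s\<^sup>2 * ((x - a) \<bullet> (x - a))"
        using s(1) by (simp add: power2_norm_eq_inner[symmetric] field_simps)
      then show ?thesis by (simp add: bump_eq_0)
    qed
  qed
  have F_eq: "?F x = ?Q x" if "x \<in> ball a s" for x
  proof -
    have "(norm (x - a))\<^sup>2 \<le> s\<^sup>2"
      using that by (intro power_mono) (auto simp: dist_norm norm_minus_commute)
    then have "1 / s\<^sup>2 * ((x - a) \<bullet> (x - a)) \<le> 1"
      using s(1) by (simp add: power2_norm_eq_inner[symmetric] field_simps)
    then show ?thesis by (simp add: bump_eq_1)
  qed
  have f_eq: "(?f \<circ> chart_inv d) x = ?Q x" if "x \<in> ball a s" for x
  proof -
    have "x \<in> chart_img d" using that s by (auto simp: subset_iff)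
    then show ?thesis
      using F_eq[OF that] by (simp add: chart_inv_in_dom chart_map_chart_inv)
  qed
  \<comment> \<open>Needed on a whole ball and not only at \<open>a\<close>, since it is
    differentiated once more for the Hessian.\<close>
  have D1: "frechet_derivative (?f \<circ> chart_inv d) (at x) w =
      w \<bullet> e - 2 * ((x - a) \<bullet> w) + B * (\<Sum>b\<in>?I. 2 * ((x - a) \<bullet> b) * (w \<bullet> b))"
    if "x \<in> ball a s" for x w
  proof -
    have "?Q differentiable at x"
      using has_derivative_inner_quadratic unfolding differentiable_def by blast
    then have eq: "frechet_derivative ?Q (at x) = frechet_derivative (?f \<circ> chart_inv d) (at x)"
      by (rule frechet_derivative_transform_within_open[OF _ open_ball that]) (rule f_eq[symmetric])
    show ?thesis
      by (rule trans[OF fun_cong[OF eq[symmetric]] frechet_derivative_inner_quadratic])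
  qed
  have "a \<in> ball a s" using s(1) by simp
  have D2: "frechet_derivative (\<lambda>x. frechet_derivative (?f \<circ> chart_inv d) (at x) w) (at a) v =
      - 2 * (v \<bullet> w) + B * ?P v w" for v w
  proof -
    let ?R = "\<lambda>x. w \<bullet> e - 2 * ((x - a) \<bullet> w) + B * (\<Sum>b\<in>?I. 2 * ((x - a) \<bullet> b) * (w \<bullet> b))"
    have "?R differentiable at a" 
      using N(1) by (auto intro!: derivative_intros simp del: sum.insert)
    then have eq: "frechet_derivative ?R (at a) =
        frechet_derivative (\<lambda>x. frechet_derivative (?f \<circ> chart_inv d) (at x) w) (at a)"
      by (rule frechet_derivative_transform_within_open[OF _ open_ball \<open>a \<in> ball a s\<close>]) (rule D1[symmetric])
    show ?thesis
      by (rule trans[OF fun_cong[OF eq[symmetric]] frechet_derivative2_inner_quadratic])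
  qed
  have deriv: "deriv_at d ?f p = (\<lambda>v. v \<bullet> e)"
  proof
    show "deriv_at d ?f p v = v \<bullet> e" for v
      using D1[OF \<open>a \<in> ball a s\<close>, of v] by (simp add: deriv_at_def flip: a_def)
  qed
  have hess: "hessian g d ?f p = (\<lambda>v w. ?H v w + B * ?P v w)"
  proof (intro ext)
    fix v w
    show "hessian g d ?f p v w = ?H v w + B * ?P v w"
      unfolding hessian_def deriv a_def[symmetric] D2 by simp
  qed
  have "local_max_on X Z ?f p"
    unfolding local_max_on_def
  proof (intro exI conjI ballI)
    let ?V = "{q \<in> chart_dom d. chart_map d q \<in> ball a (min \<delta> s)} \<inter> V"
    show "openin X ?V"
      by (intro openin_Int openin_chart_map_vimage[OF chart] V open_ball)
    show "p \<in> ?V" using p pd \<delta>(1) s(1) by (simp add: a_def)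
    fix q assume q: "q \<in> ?V \<inter> Z"
    then have "?f q = ?Q (chart_map d q)" using F_eq by simp
    also have "\<dots> \<le> 0" using q by (intro \<delta>(2)) (auto simp: dist_norm norm_minus_commute)
    also have "0 = ?f p" by (simp add: a_def)
    finally show "?f q \<le> ?f p" .
  qed
  then have "Trace_lowest m ?G (hessian g d ?f p) \<le> h * dual_norm ?G (deriv_at d ?f p)"
    using Z \<open>Ck_function 2 A ?f\<close> p(1) d pd unfolding mh_subset_def by blast
  then show False using trace unfolding deriv hess by simp
qed

section \<open>Estimates for C^1 chart changes, and a connectedness argument\<close>

text \<open>Continuity of the finitely many partial derivatives makes the derivative nearly constant
  in operator norm on a ball. The mean value inequality for \<open>f\<close> minus its derivative at
  \<open>x0\<close> then gives the estimate for pairs of points.\<close>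

lemma C1_strictly_differentiable:
  fixes f :: "'e::euclidean_space \<Rightarrow> 'f::real_normed_vector"
  assumes S: "open S" "x0 \<in> S" and f: "Ck_on 1 S f" and \<eta>: "0 < \<eta>"
  obtains \<rho> where "0 < \<rho>" "ball x0 \<rho> \<subseteq> S"
    "\<And>x w. x \<in> ball x0 \<rho> \<Longrightarrow>
      norm (frechet_derivative f (at x) w - frechet_derivative f (at x0) w) \<le> \<eta> * norm w"
    "\<And>x y. x \<in> ball x0 \<rho> \<Longrightarrow> y \<in> ball x0 \<rho> \<Longrightarrow>
      norm (f x - f y - frechet_derivative f (at x0) (x - y)) \<le> \<eta> * norm (x - y)"
proof -
  let ?D = "\<lambda>x. frechet_derivative f (at x)"
  have der: "(f has_derivative ?D x) (at x)" if "x \<in> S" for x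
    using f that by (intro Ck_on_Suc_has_derivative[of 0]) simp_all
  \<comment> \<open>The share \<open>\<eta> / DIM('e)\<close> per basis vector adds up to
    \<open>\<eta>\<close>.\<close>
  have "eventually (\<lambda>x. norm (?D x b - ?D x0 b) < \<eta> / DIM('e)) (nhds x0)" for b
  proof -
    have "isCont (\<lambda>x. ?D x b) x0"
      using f S by (simp add: continuous_on_eq_continuous_at)
    then have "((\<lambda>x. ?D x b) \<longlongrightarrow> ?D x0 b) (nhds x0)"
      using tendsto_at_iff_tendsto_nhds[of "\<lambda>x. ?D x b" x0] by (simp add: isCont_def)
    then show ?thesis
      using \<eta> by (auto simp: tendsto_iff dist_norm)
  qed
  then have "eventually (\<lambda>x. (\<forall>b\<in>Basis. norm (?D x b - ?D x0 b) < \<eta> / DIM('e)) \<and> x \<in> S) (nhds x0)"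
    using S by (intro eventually_conj eventually_ball_finite ballI eventually_nhds_in_open) auto
  then obtain \<rho> where \<rho>: "0 < \<rho>"
    and near: "\<And>x. dist x x0 < \<rho> \<Longrightarrow> (\<forall>b\<in>Basis. norm (?D x b - ?D x0 b) < \<eta> / DIM('e)) \<and> x \<in> S"
    unfolding eventually_nhds_metric by blast
  have sub: "ball x0 \<rho> \<subseteq> S" using near by (auto simp: dist_commute)
  have close: "norm (?D x w - ?D x0 w) \<le> \<eta> * norm w" if x: "x \<in> ball x0 \<rho>" for x w
  proof -
    have lin: "linear (\<lambda>w. ?D x w - ?D x0 w)"
      using x sub
      by (intro linear_compose_sub has_derivative_linear[OF der[OF S(2)]] has_derivative_linear[OF der]) auto
    have "?D x w - ?D x0 w = (\<Sum>b\<in>Basis. (w \<bullet> b) *\<^sub>R (?D x b - ?D x0 b))"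
      using linear_sum[OF lin, of "\<lambda>b. (w \<bullet> b) *\<^sub>R b" Basis]
      unfolding euclidean_representation linear_cmul[OF lin] .
    also have "norm \<dots> \<le> (\<Sum>b\<in>(Basis::'e set). norm w * (\<eta> / DIM('e)))"
    proof (intro sum_norm_le)
      fix b :: 'e assume b: "b \<in> Basis"
      have "\<bar>w \<bullet> b\<bar> * norm (?D x b - ?D x0 b) \<le> norm w * (\<eta> / DIM('e))"
        using near[of x] x b
        by (intro mult_mono Basis_le_norm) (auto simp: dist_commute intro: less_imp_le)
      then show "norm ((w \<bullet> b) *\<^sub>R (?D x b - ?D x0 b)) \<le> norm w * (\<eta> / DIM('e))" by simp
    qed
    also have "\<dots> = \<eta> * norm w" by simp
    finally show ?thesis .
  qed
  have "norm ((f x - ?D x0 x) - (f y - ?D x0 y)) \<le> \<eta> * norm (x - y)"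
    if "x \<in> ball x0 \<rho>" "y \<in> ball x0 \<rho>" for x y
  proof (rule differentiable_bound[OF convex_ball _ _ that])
    fix z assume z: "z \<in> ball x0 \<rho>"
    have "bounded_linear (?D x0)" using der S has_derivative_bounded_linear by blast
    then show "((\<lambda>x. f x - ?D x0 x) has_derivative (\<lambda>w. ?D z w - ?D x0 w)) (at z within ball x0 \<rho>)"
      using der z sub
      by (intro has_derivative_diff has_derivative_at_withinI[OF der] bounded_linear_imp_has_derivative) auto
    show "onorm (\<lambda>w. ?D z w - ?D x0 w) \<le> \<eta>"
      by (rule onorm_le) (rule close[OF z])
  qed
  moreover have "(f x - ?D x0 x) - (f y - ?D x0 y) = f x - f y - ?D x0 (x - y)" for x y
    using linear_diff[OF has_derivative_linear[OF der[OF S(2)]], of x y] by simp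
  ultimately show thesis using that[OF \<rho> sub close] by simp
qed

text \<open>The opposite transition is a differentiable inverse, so the chain rule gives a left
  inverse of the derivative; an injective linear map in finite dimension is bounded below.\<close>

lemma transition_derivative_bounded_below:
  fixes c d :: "('a, 'e::euclidean_space) chart"
  assumes c: "is_chart X c" and d: "is_chart X d" and comp: "Ck_compatible 1 c d"
    and p: "p \<in> chart_dom c" "p \<in> chart_dom d"
  obtains \<kappa> where "0 < \<kappa>"
    "\<And>w. \<kappa> * norm w \<le> norm (frechet_derivative (transition c d) (at (chart_map c p)) w)"
proof -
  let ?O = "chart_map c ` (chart_dom c \<inter> chart_dom d)"
    and ?O' = "chart_map d ` (chart_dom c \<inter> chart_dom d)"
  let ?x = "chart_map c p" and ?y = "chart_map d p"
  let ?D = "frechet_derivative (transition c d) (at ?x)"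
    and ?E = "frechet_derivative (transition d c) (at ?y)"
  have y: "transition c d ?x = ?y"
    using p by (simp add: transition_def chart_inv_chart_map[OF c])
  have O: "open ?O"
    using open_chart_map_image[OF c] d unfolding is_chart_def by blast
  have "?x \<in> ?O" "?y \<in> ?O'" using p by blast+
  have D: "(transition c d has_derivative ?D) (at ?x)"
    using comp \<open>?x \<in> ?O\<close> by (intro Ck_on_Suc_has_derivative[of 0]) (auto simp: Ck_compatible_def)
  have E: "(transition d c has_derivative ?E) (at (transition c d ?x))"
    unfolding y
    using comp \<open>?y \<in> ?O'\<close> by (intro Ck_on_Suc_has_derivative[of 0]) (auto simp: Ck_compatible_def)
  have "((\<lambda>x. x) has_derivative (\<lambda>w. ?E (?D w))) (at ?x)"
    using has_derivative_compose[OF D E]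
  proof (rule has_derivative_transform_within_open[OF _ O \<open>?x \<in> ?O\<close>])
    show "transition d c (transition c d x) = x" if "x \<in> ?O" for x
      using that by (auto simp: transition_def chart_inv_chart_map[OF c] chart_inv_chart_map[OF d])
  qed
  then have "(\<lambda>w. ?E (?D w)) = (\<lambda>w. w)"
    using has_derivative_unique has_derivative_ident by blast
  then have "inj ?D" by (metis injI)
  then show thesis
    using linear_inj_bounded_below_pos[OF has_derivative_linear[OF D]] that by blast
qed

text \<open>Otherwise \<open>Z\<close> would be relatively open as well as closed in the connected
  set \<open>M\<close>, with \<open>U\<close> below as the open set cutting it out.\<close>

lemma connected_proper_closed_subset_boundary_point:
  assumes M: "connectedin X M" and Z: "closedin X Z" "Z \<subseteq> M" "Z \<noteq> {}" "Z \<noteq> M"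
  shows "\<exists>p\<in>Z. \<forall>V. openin X V \<longrightarrow> p \<in> V \<longrightarrow> (\<exists>q\<in>V. q \<in> M \<and> q \<notin> Z)"
proof (rule ccontr)
  assume "\<not> ?thesis"
  then have *: "\<exists>V. openin X V \<and> p \<in> V \<and> V \<inter> M \<subseteq> Z" if "p \<in> Z" for p
    using that by blast
  define U where "U = \<Union>{V. openin X V \<and> V \<inter> M \<subseteq> Z}"
  have U: "openin X U" "U \<inter> M \<subseteq> Z" by (auto simp: U_def)
  have "Z \<subseteq> U" using * by (auto simp: U_def)
  have "openin X (topspace X - Z)" using Z(1) by blast
  moreover have "M \<subseteq> U \<union> (topspace X - Z)"
    using M \<open>Z \<subseteq> U\<close> connectedin_subset_topspace by fastforce
  moreover have "U \<inter> (topspace X - Z) \<inter> M = {}" using U(2) by blast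
  moreover have "U \<inter> M \<noteq> {}" "(topspace X - Z) \<inter> M \<noteq> {}"
    using Z \<open>Z \<subseteq> U\<close> M connectedin_subset_topspace by blast+
  ultimately show False using M U(1) unfolding connectedin by blast
qed

section \<open>Construction of the touching point and proof of the theorem\<close>

theorem theorem1p3:
  fixes X :: "'a topology"
    and A :: "('a, 'e::euclidean_space) chart set"
    and g :: "('a, 'e) metric_components"
    and m :: nat and h :: real
    and Z M :: "'a set"
  assumes "smooth_manifold X A"
    and "Ck_riemannian_metric 1 A g"
    and "mh_subset X A g m h Z"
    and "Z \<subseteq> M"
    and "connectedin X M"
    and "Ck_submanifold 1 X A m M"
    and "properly_embedded X M"
  shows "Z = {} \<or> Z = M"
proof (rule ccontr)
  assume "\<not> ?thesis"
  then have Zne: "Z \<noteq> {}" "Z \<noteq> M" by auto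
  have Z: "closedin X Z" using assms(3) by (simp add: mh_subset_def)
  obtain p0 where p0: "p0 \<in> Z" and bd: "\<And>V. openin X V \<Longrightarrow> p0 \<in> V \<Longrightarrow> \<exists>q\<in>V. q \<in> M \<and> q \<notin> Z"
    using connected_proper_closed_subset_boundary_point[OF assms(5) Z assms(4) Zne] by blast
  have "p0 \<in> M" using p0 assms(4) by blast
  then obtain c S where c: "is_chart X c" "p0 \<in> chart_dom c" and compat: "\<forall>d\<in>A. Ck_compatible 1 c d"
    and S: "subspace S" "dim S = m" "chart_map c ` (chart_dom c \<inter> M) = chart_img c \<inter> S"
    using assms(6) unfolding Ck_submanifold_def by blast
  have "p0 \<in> topspace X" using c chart_dom_subset by blast
  then have "p0 \<in> (\<Union>d\<in>A. chart_dom d)" using assms(1) by (simp add: smooth_manifold_def)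
  \<comment> \<open>Two charts are used: \<open>M\<close> is a linear slice in \<open>c\<close>,
    which is only C^1-compatible with the atlas, while C^2 test functions, the metric and the
    distance require a chart \<open>d\<close> of the atlas.\<close>
  then obtain d where d: "d \<in> A" "p0 \<in> chart_dom d" by blast
  have dc: "is_chart X d" using assms(1) d by (simp add: smooth_manifold_def)
  have comp: "Ck_compatible 1 c d" using compat d by blast
  let ?\<psi> = "transition c d" and ?O = "chart_map c ` (chart_dom c \<inter> chart_dom d)"
  let ?D = "\<lambda>x. frechet_derivative ?\<psi> (at x)" and ?xc = "chart_map c p0"
  have O: "open ?O" "?xc \<in> ?O"
    using open_chart_map_image[OF c(1)] dc c(2) d(2) unfolding is_chart_def by blast+
  have \<psi>: "Ck_on 1 ?O ?\<psi>" using comp by (simp add: Ck_compatible_def)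
  have \<psi>_eq: "?\<psi> (chart_map c q) = chart_map d q" if "q \<in> chart_dom c" for q
    using that by (simp add: transition_def chart_inv_chart_map[OF c(1)])
  obtain \<kappa> where \<kappa>: "0 < \<kappa>" "\<And>w. \<kappa> * norm w \<le> norm (?D ?xc w)"
    using transition_derivative_bounded_below[OF c(1) dc comp c(2) d(2)] by blast
  \<comment> \<open>Each comparison with the derivative at \<open>?xc\<close> costs
    \<open>\<eta>\<close>, which leaves lower bounds \<open>3 * \<eta>\<close>. These must beat the
    error \<open>2 * \<eta>\<close> of the secant below.\<close>
  define \<eta> where "\<eta> = \<kappa> / 4"
  have \<eta>: "0 < \<eta>" "\<kappa> = 4 * \<eta>" using \<kappa>(1) by (simp_all add: \<eta>_def)
  obtain \<rho> where \<rho>: "0 < \<rho>" "ball ?xc \<rho> \<subseteq> ?O"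
    and close: "\<And>x w. x \<in> ball ?xc \<rho> \<Longrightarrow> norm (?D x w - ?D ?xc w) \<le> \<eta> * norm w"
    and strict: "\<And>x y. x \<in> ball ?xc \<rho> \<Longrightarrow> y \<in> ball ?xc \<rho> \<Longrightarrow>
      norm (?\<psi> x - ?\<psi> y - ?D ?xc (x - y)) \<le> \<eta> * norm (x - y)"
    using C1_strictly_differentiable[OF O \<psi> \<eta>(1)] by blast
  have D_below: "3 * \<eta> * norm w \<le> norm (?D x w)" if "x \<in> ball ?xc \<rho>" for x w
    using \<kappa>(2)[of w] close[OF that, of w] norm_triangle_ineq2[of "?D ?xc w" "?D x w"]
    by (simp add: \<eta>(2) norm_minus_commute)
  have \<psi>_below: "3 * \<eta> * norm (x - y) \<le> norm (?\<psi> x - ?\<psi> y)"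
    if "x \<in> ball ?xc \<rho>" "y \<in> ball ?xc \<rho>" for x y
    using \<kappa>(2)[of "x - y"] strict[OF that] norm_triangle_ineq2[of "?D ?xc (x - y)" "?\<psi> x - ?\<psi> y"]
    by (simp add: \<eta>(2) norm_minus_commute)
  define V where "V = {q \<in> chart_dom c. chart_map c q \<in> ball ?xc \<rho>}"
  have V_open: "openin X V" unfolding V_def by (rule openin_chart_map_vimage[OF c(1) open_ball])
  have V_c: "V \<subseteq> chart_dom c" by (auto simp: V_def)
  have V_d: "V \<subseteq> chart_dom d"
  proof
    fix q assume q: "q \<in> V"
    then obtain q' where "q' \<in> chart_dom c" "q' \<in> chart_dom d" "chart_map c q = chart_map c q'"
      using \<rho>(2) unfolding V_def by blast
    then show "q \<in> chart_dom d"
      using q V_c inj_on_chart_map[OF c(1)] unfolding inj_on_def by blast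
  qed
  have p0V: "p0 \<in> V" using c(2) \<rho>(1) by (simp add: V_def)
  have "open (chart_map d ` (chart_dom d \<inter> V))" by (rule open_chart_map_image[OF dc V_open])
  moreover have "chart_map d p0 \<in> chart_map d ` (chart_dom d \<inter> V)" using p0V d(2) by blast
  ultimately obtain r where r: "0 < r" "ball (chart_map d p0) r \<subseteq> chart_map d ` (chart_dom d \<inter> V)"
    using open_contains_ball by blast
  \<comment> \<open>The point \<open>q\<close> will be within \<open>\<sigma>\<close> of
    \<open>p0\<close>, so the closed ball of radius \<open>\<sigma>\<close> around it stays within
    \<open>2 * \<sigma> < r\<close> of \<open>p0\<close>, inside the image of
    \<open>V\<close>.\<close>
  define \<sigma> where "\<sigma> = r / 4"
  have \<sigma>: "0 < \<sigma>" "r = 4 * \<sigma>" using r(1) by (simp_all add: \<sigma>_def)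
  have "openin X ({q \<in> chart_dom d. chart_map d q \<in> ball (chart_map d p0) \<sigma>} \<inter> V)"
    by (intro openin_Int openin_chart_map_vimage[OF dc] V_open open_ball)
  from bd[OF this] obtain q where q: "q \<in> M" "q \<notin> Z" "q \<in> V" "dist (chart_map d p0) (chart_map d q) < \<sigma>"
    using p0V d(2) \<sigma>(1) by auto
  let ?y = "chart_map d q"
  let ?K = "cball ?y \<sigma> \<inter> chart_map d ` (Z \<inter> V)"
  have inV: "cball ?y \<sigma> \<subseteq> chart_map d ` (chart_dom d \<inter> V)"
  proof (rule order_trans[OF _ r(2)], rule subsetI)
    fix z assume "z \<in> cball ?y \<sigma>"
    then show "z \<in> ball (chart_map d p0) r"
      using q(4) \<sigma> dist_triangle[of "chart_map d p0" z ?y] by simp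
  qed
  have inj: "z = z'" if "chart_map d z = chart_map d z'" "z \<in> V" "z' \<in> V" for z z'
    using inj_on_chart_map[OF dc] that V_d unfolding inj_on_def by blast
  \<comment> \<open>Closedness of \<open>?K\<close>: since the ball lies in the image of
    \<open>V\<close>, intersecting with the image of \<open>Z \<inter> V\<close> amounts to removing
    the open image of \<open>V - Z\<close>.\<close>
  have "?K = cball ?y \<sigma> - chart_map d ` (chart_dom d \<inter> (V \<inter> (topspace X - Z)))"
  proof (rule set_eqI, rule iffI)
    fix x assume x: "x \<in> ?K"
    then obtain z where z: "z \<in> Z" "z \<in> V" "x = chart_map d z" by blast
    have "z' \<in> Z" if "z' \<in> V" "x = chart_map d z'" for z'
      using inj[of z z'] z that by simp
    then show "x \<in> cball ?y \<sigma> - chart_map d ` (chart_dom d \<inter> (V \<inter> (topspace X - Z)))"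
      using x by blast
  next
    fix x assume x: "x \<in> cball ?y \<sigma> - chart_map d ` (chart_dom d \<inter> (V \<inter> (topspace X - Z)))"
    then obtain z where z: "z \<in> chart_dom d" "z \<in> V" "x = chart_map d z"
      using inV by blast
    have "z \<in> topspace X" using z chart_dom_subset[OF dc] by blast
    then show "x \<in> ?K" using x z by blast
  qed
  moreover have "open (chart_map d ` (chart_dom d \<inter> (V \<inter> (topspace X - Z))))"
    using Z V_open by (intro open_chart_map_image[OF dc] openin_Int) auto
  ultimately have "closed ?K" by (simp add: closed_Diff)
  moreover have p0K: "chart_map d p0 \<in> ?K" using q(4) p0 p0V by (auto simp: dist_commute)
  ultimately obtain x1 where x1: "x1 \<in> ?K" and min: "\<And>z. z \<in> ?K \<Longrightarrow> dist ?y x1 \<le> dist ?y z"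
    using distance_attains_inf[of ?K ?y] by blast
  obtain p where p: "p \<in> Z" "p \<in> V" "x1 = chart_map d p" using x1 by blast
  define e where "e = chart_map d q - chart_map d p"
  let ?xp = "chart_map c p" and ?w = "chart_map c q - chart_map c p"
  have slice: "chart_map c z \<in> S" if "z \<in> M" "z \<in> V" for z
    using S(3) that V_c by blast
  have xball: "chart_map c z \<in> ball ?xc \<rho>" if "z \<in> V" for z
    using that by (simp add: V_def)
  have Dx: "(?\<psi> has_derivative ?D ?xp) (at ?xp)"
    using \<psi> unfolding One_nat_def
    by (rule Ck_on_Suc_has_derivative) (rule subsetD[OF \<rho>(2) xball[OF p(2)]])
  \<comment> \<open>The tangent space of \<open>M\<close> at \<open>p\<close>, seen in the chart
    \<open>d\<close>.\<close>
  define T where "T = ?D ?xp ` S"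
  have T: "subspace T"
    unfolding T_def by (rule linear_subspace_image[OF has_derivative_linear[OF Dx] S(1)])
  have "inj (?D ?xp)"
  proof -
    have "w = 0" if "?D ?xp w = 0" for w
      using D_below[OF xball[OF p(2)], of w] that \<eta>(1) by (simp add: mult_le_0_iff)
    then show ?thesis
      unfolding linear_injective_0[OF has_derivative_linear[OF Dx]] by blast
  qed
  then have "dim T = m"
    unfolding T_def S(2)[symmetric]
    by (intro dim_image_eq has_derivative_linear[OF Dx]) (auto intro: inj_on_subset)
  have wS: "?w \<in> S"
    using slice[OF q(1,3)] slice[of p] p assms(4) S(1) by (auto intro: subspace_diff)
  have "?w \<noteq> 0"
    using inj_on_chart_map[OF c(1)] V_c p q(2,3) by (auto simp: inj_on_def)
  let ?t = "?D ?xp ?w"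
  \<comment> \<open>The secant \<open>e\<close> differs from the tangent vector \<open>?t\<close> by
    less than \<open>norm ?t\<close>, so
    \<open>?t \<bullet> e = ?t \<bullet> ?t + ?t \<bullet> (e - ?t)\<close> is positive by
    Cauchy-Schwarz.\<close>
  have "?t \<bullet> e \<noteq> 0"
  proof -
    have "norm (e - ?D ?xc ?w) \<le> \<eta> * norm ?w"
      using strict[OF xball[OF q(3)] xball[OF p(2)]] V_c p(2) q(3) by (auto simp: e_def \<psi>_eq subset_iff)
    then have "norm (e - ?t) \<le> 2 * \<eta> * norm ?w"
      using close[OF xball[OF p(2)], of ?w] norm_triangle_ineq4[of "e - ?D ?xc ?w" "?t - ?D ?xc ?w"] by simp
    moreover have "2 * \<eta> * norm ?w < 3 * \<eta> * norm ?w" using \<eta>(1) \<open>?w \<noteq> 0\<close> by simp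
    ultimately have lt: "norm (e - ?t) < norm ?t" using D_below[OF xball[OF p(2)], of ?w] by linarith
    then have "0 < norm ?t" using norm_ge_zero[of "e - ?t"] by linarith
    have "- (?t \<bullet> (e - ?t)) \<le> norm ?t * norm (e - ?t)"
      using Cauchy_Schwarz_ineq2[of ?t "e - ?t"] by linarith
    also have "\<dots> < norm ?t * norm ?t" using lt \<open>0 < norm ?t\<close> by simp
    also have "\<dots> = ?t \<bullet> ?t" by (simp add: dot_square_norm power2_eq_square)
    finally show ?thesis by (simp add: inner_diff_right)
  qed
  show False
  proof (rule mh_subset_no_inner_touching[OF assms(1-3) d(1) p(1,2) V_open V_d T \<open>dim T = m\<close> _ \<open>?t \<bullet> e \<noteq> 0\<close>])
    show "?t \<in> T" using wS by (simp add: T_def)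
    show "norm e \<le> norm (chart_map d z - (chart_map d p + e))" if z: "z \<in> Z \<inter> V" for z
    proof -
      \<comment> \<open>The nearest point of \<open>?K\<close> is nearest in all of
        \<open>Z \<inter> V\<close>: points outside the closed ball are farther from
        \<open>?y\<close> than \<open>p0\<close>, which competes in \<open>?K\<close>.\<close>
      have "dist ?y x1 \<le> dist ?y (chart_map d z)"
      proof (cases "chart_map d z \<in> cball ?y \<sigma>")
        case True
        then show ?thesis using min z by blast
      next
        case False
        then show ?thesis using min[OF p0K] q(4) by (simp add: dist_commute)
      qed
      then show ?thesis by (simp add: e_def p(3) dist_norm norm_minus_commute)
    qed
    show "\<exists>\<delta>>0. \<forall>z\<in>Z \<inter> V. norm (chart_map d z - chart_map d p) < \<delta> \<longrightarrow>
        (\<exists>s\<in>T. norm (chart_map d z - chart_map d p - s) \<le> \<epsilon> * norm (chart_map d z - chart_map d p))"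
      if "0 < \<epsilon>" for \<epsilon>
    proof -
      \<comment> \<open>The factor \<open>3 * \<eta>\<close> converts the error from coordinate
        distances in \<open>c\<close> to those in \<open>d\<close> by \<open>\<psi>_below\<close>;
        the radius \<open>3 * \<eta> * \<delta>\<close> has the same origin.\<close>
      have "0 < \<epsilon> * (3 * \<eta>)" using that \<eta>(1) by simp
      then obtain \<delta> where \<delta>: "0 < \<delta>" and approx: "\<And>x. norm (x - ?xp) < \<delta> \<Longrightarrow>
          norm (?\<psi> x - ?\<psi> ?xp - ?D ?xp (x - ?xp)) \<le> \<epsilon> * (3 * \<eta>) * norm (x - ?xp)"
        using Dx unfolding has_derivative_at_alt by blast
      show ?thesis
      proof (intro exI conjI ballI impI)
        show "0 < 3 * \<eta> * \<delta>" using \<eta>(1) \<delta> by simp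
        fix z assume z: "z \<in> Z \<inter> V" and lt: "norm (chart_map d z - chart_map d p) < 3 * \<eta> * \<delta>"
        let ?u = "chart_map c z - ?xp"
        have \<psi>z: "?\<psi> (chart_map c z) = chart_map d z" "?\<psi> ?xp = chart_map d p"
          using z p(2) V_c by (auto intro: \<psi>_eq)
        have below: "3 * \<eta> * norm ?u \<le> norm (chart_map d z - chart_map d p)"
          using \<psi>_below[OF xball xball, of z p] z p(2) by (simp add: \<psi>z)
        then have "3 * \<eta> * norm ?u < 3 * \<eta> * \<delta>" using lt by linarith
        then have "norm ?u < \<delta>" using \<eta>(1) by simp
        from approx[OF this] have "norm (chart_map d z - chart_map d p - ?D ?xp ?u) \<le> \<epsilon> * (3 * \<eta> * norm ?u)"
          by (simp add: \<psi>z mult.assoc)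
        also have "\<dots> \<le> \<epsilon> * norm (chart_map d z - chart_map d p)"
          using below that by (intro mult_left_mono) auto
        finally show "\<exists>s\<in>T. norm (chart_map d z - chart_map d p - s) \<le> \<epsilon> * norm (chart_map d z - chart_map d p)"
        proof (rule bexI)
          have "?u \<in> S"
            using slice[of z] slice[of p] z p assms(4) S(1) by (auto intro: subspace_diff)
          then show "?D ?xp ?u \<in> T" by (simp add: T_def)
        qed
      qed
    qed
  qed
qed

end
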